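(* Let $q$ be a prime power, let $k\ge 1$ be an integer, put $n=(q^k-1)/(q-1)$, and let $H$ be a $k\times n$ parity check matrix over $\mathbb{F}_q$ of a $q$-ary cyclic Hamming code of length $n$ (hence $\gcd(n,q-1)=1$). For $i\ge 1$ let $H_i$ be the matrix obtained from $H$ by cyclically shifting its columns $i$ times to the right. Let $c\in\{2,\ldots,n\}$ and let $C\subseteq\mathbb{F}_q^{nc}$ be the linear code with parity check matrix $$\begin{bmatrix} H & H & \cdots & H\\ H_1 & H_2 & \cdots & H_c\end{bmatrix}.$$ Then $C$ is a quasi-perfect uniformly packed code (hence completely regular) with parameters $[nc,\,nc-2k,\,3;\,2]_q$ and intersection array $$\{(q-1)nc,\ \left((q-1)n-c+2\right)(c-1);\ 1,\ c(c-1)\}.$$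
   Context: A $q$-ary Hamming code of length $n=(q^k-1)/(q-1)$ is a linear code with a $k\times n$ parity check matrix whose columns are representatives of the $n$ one-dimensional subspaces of $\mathbb{F}_q^k$, one for each; it is cyclic if it is invariant under the cyclic shift of coordinates $(x_1,\ldots,x_n)\mapsto(x_n,x_1,\ldots,x_{n-1})$. The code with parity check matrix $P$ is $\{x: Px^T=0\}$. Distances are Hamming distances. For a code $C\subseteq\mathbb{F}_q^N$, $d(x,C)=\min_{y\in C}d(x,y)$; the covering radius is $\rho=\max_x d(x,C)$; an $[N,K,d;\rho]_q$ code is a linear code of length $N$, dimension $K$, minimum distance $d$ and covering radius $\rho$ over $\mathbb{F}_q$; its packing radius is $e=\lfloor (d-1)/2\rfloor$. Let $C(i)=\{x\in\mathbb{F}_q^N: d(x,C)=i\}$ for $0\le i\le\rho$. Two vectors are neighbors if they are at distance $1$. $C$ is completely regular if for every $l\in\{0,\ldots,\rho\}$ every $x\in C(l)$ has the same number $c_l$ of neighbors in $C(l-1)$ and the same number $b_l$ of neighbors in $C(l+1)$ (with $c_0=b_\rho=0$). Its intersection array is $\{b_0,\ldots,b_{\rho-1};c_1,\ldots,c_\rho\}$. $C$ is quasi-perfect if $\rho=e+1$. A quasi-perfect code $C$ is uniformly packed if there are natural numbers $\lambda,\mu$ such that for every vector $x$ the number $B_{x,e+1}$ of codewords at distance exactly $e+1$ from $x$ equals $\lambda$ if $d(x,C)=e$ and equals $\mu$ if $d(x,C)=e+1$. *)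

theory Defs
  imports "Jordan_Normal_Form.Matrix_Kernel"
begin

abbreviation subvectorspace :: "nat \<Rightarrow> 'a :: field vec set \<Rightarrow> bool" where
  "subvectorspace N W \<equiv> VectorSpace.subspace class_ring W (module_vec TYPE('a) N)"

abbreviation subspace_dim :: "nat \<Rightarrow> 'a :: field vec set \<Rightarrow> nat" where
  "subspace_dim N W \<equiv> vectorspace.dim class_ring ((module_vec TYPE('a) N)\<lparr>carrier := W\<rparr>)"

abbreviation vec_span :: "nat \<Rightarrow> 'a :: field vec set \<Rightarrow> 'a vec set" where
  "vec_span N S \<equiv> LinearCombinations.module.span class_ring (module_vec TYPE('a) N) S"

definition hamming_dist :: "'a vec \<Rightarrow> 'a vec \<Rightarrow> nat" where
  "hamming_dist x y = card {i. i < dim_vec x \<and> x $ i \<noteq> y $ i}"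

text \<open>A code is a set of vectors; since this set does not determine the ambient space, the length
  \<open>N\<close> is an explicit argument wherever it matters. The minima and maxima below are over finite
  nonempty sets for a code of positive dimension over a finite field.\<close>

definition dist_to_code :: "'a vec \<Rightarrow> 'a vec set \<Rightarrow> nat" where
  "dist_to_code x C = Min (hamming_dist x ` C)"

definition covering_radius :: "nat \<Rightarrow> 'a vec set \<Rightarrow> nat" where
  "covering_radius N C = Max ((\<lambda>x. dist_to_code x C) ` carrier_vec N)"

definition min_distance :: "'a vec set \<Rightarrow> nat" where
  "min_distance C = Min {hamming_dist x y | x y. x \<in> C \<and> y \<in> C \<and> x \<noteq> y}"

definition packing_radius :: "'a vec set \<Rightarrow> nat" where
  "packing_radius C = (min_distance C - 1) div 2"

definition linear_code_params ::
    "nat \<Rightarrow> nat \<Rightarrow> nat \<Rightarrow> nat \<Rightarrow> 'a :: field vec set \<Rightarrow> bool" where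
  "linear_code_params N K d r C \<longleftrightarrow>
     subvectorspace N C \<and> subspace_dim N C = K \<and> min_distance C = d \<and> covering_radius N C = r"

definition layer :: "nat \<Rightarrow> 'a vec set \<Rightarrow> nat \<Rightarrow> 'a vec set" where
  "layer N C i = {x \<in> carrier_vec N. dist_to_code x C = i}"

definition neighbors :: "nat \<Rightarrow> 'a vec \<Rightarrow> 'a vec set" where
  "neighbors N x = {y \<in> carrier_vec N. hamming_dist x y = 1}"

text \<open>The set of neighbors one layer below is written with \<open>Suc (dist_to_code y C) = l\<close>, so that
  it is empty for \<open>l = 0\<close>. Hence \<open>c 0 = 0\<close>, and likewise \<open>b\<close> vanishes at the covering radius.\<close>

definition intersection_numbers ::
    "nat \<Rightarrow> 'a vec set \<Rightarrow> (nat \<Rightarrow> nat) \<Rightarrow> (nat \<Rightarrow> nat) \<Rightarrow> bool" where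
  "intersection_numbers N C b c \<longleftrightarrow>
     (\<forall>l \<le> covering_radius N C. \<forall>x \<in> layer N C l.
        card {y \<in> neighbors N x. Suc (dist_to_code y C) = l} = c l \<and>
        card {y \<in> neighbors N x. dist_to_code y C = Suc l} = b l)"

definition completely_regular :: "nat \<Rightarrow> 'a vec set \<Rightarrow> bool" where
  "completely_regular N C \<longleftrightarrow> (\<exists>b c. intersection_numbers N C b c)"

definition has_intersection_array :: "nat \<Rightarrow> 'a vec set \<Rightarrow> nat list \<Rightarrow> nat list \<Rightarrow> bool" where
  "has_intersection_array N C bs cs \<longleftrightarrow>
     (\<exists>b c. intersection_numbers N C b c \<and>
        bs = map b [0..<covering_radius N C] \<and> cs = map c [1..<Suc (covering_radius N C)])"

definition quasi_perfect :: "nat \<Rightarrow> 'a vec set \<Rightarrow> bool" where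
  "quasi_perfect N C \<longleftrightarrow> covering_radius N C = packing_radius C + 1"

definition uniformly_packed :: "nat \<Rightarrow> 'a vec set \<Rightarrow> bool" where
  "uniformly_packed N C \<longleftrightarrow> quasi_perfect N C \<and>
     (\<exists>l m. \<forall>x \<in> carrier_vec N.
        (dist_to_code x C = packing_radius C \<longrightarrow>
           card {y \<in> C. hamming_dist x y = packing_radius C + 1} = l) \<and>
        (dist_to_code x C = packing_radius C + 1 \<longrightarrow>
           card {y \<in> C. hamming_dist x y = packing_radius C + 1} = m))"

text \<open>The code with parity check matrix \<open>P\<close> is \<open>mat_kernel P\<close>.\<close>

definition hamming_check_matrix :: "nat \<Rightarrow> nat \<Rightarrow> 'a :: field mat \<Rightarrow> bool" where
  "hamming_check_matrix k n H \<longleftrightarrow> H \<in> carrier_mat k n \<and>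
     bij_betw (\<lambda>j. vec_span k {col H j}) {..<n} {L. subvectorspace k L \<and> subspace_dim k L = 1}"

definition cyclic_shift :: "'a vec \<Rightarrow> 'a vec" where
  "cyclic_shift x = vec (dim_vec x) (\<lambda>j. x $ ((j + dim_vec x - 1) mod dim_vec x))"

definition cyclic_code :: "'a vec set \<Rightarrow> bool" where
  "cyclic_code C \<longleftrightarrow> (\<forall>x \<in> C. cyclic_shift x \<in> C)"

definition shift_cols :: "'a mat \<Rightarrow> 'a mat" where
  "shift_cols A = mat (dim_row A) (dim_col A) (\<lambda>(i, j). A $$ (i, (j + dim_col A - 1) mod dim_col A))"

text \<open>The matrix with block rows \<open>[H, \<dots>, H]\<close> and \<open>[H\<^sub>1, \<dots>, H\<^sub>c]\<close>, where
  \<open>H\<^sub>i\<close> is \<open>H\<close> with its columns shifted \<open>i\<close> times. As column indices start at \<open>0\<close>, column \<open>j\<close> lies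
  in block number \<open>j div n + 1\<close>.\<close>

definition shifted_block_matrix :: "nat \<Rightarrow> 'a mat \<Rightarrow> 'a mat" where
  "shifted_block_matrix c H = (let k = dim_row H; n = dim_col H in
     mat (2 * k) (n * c) (\<lambda>(i, j).
       if i < k then H $$ (i, j mod n)
       else (shift_cols ^^ (j div n + 1)) H $$ (i - k, j mod n)))"

end

theory Submission
  imports Defs
begin

text \<open>Let \<open>h\<^sub>0, \<dots>, h\<^bsub>n-1\<^esub>\<close> be the columns of \<open>H\<close>. Cyclicity yields a linear map \<open>T\<close> with
  \<open>T h\<^sub>j = h\<^bsub>j+1\<^esub>\<close> (indices modulo \<open>n\<close>), and no power \<open>T\<^bsup>m\<^esup>\<close> with \<open>0 < m < n\<close> has an eigenvector,
  since every nonzero vector is a multiple of exactly one \<open>h\<^sub>j\<close>. Hence the multiples of the columns in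
  the \<open>i\<close>-th block of the check matrix of \<open>C\<close>, together with zero, form the subspace
  \<open>V\<^sub>i = {(v, T\<^bsup>-i\<^esup> v)}\<close>, and any two of \<open>V\<^sub>1, \<dots>, V\<^sub>c\<close> are complementary. Let \<open>D\<close> be the union of
  the \<open>V\<^sub>i\<close> without zero. A vector is in the code, at distance 1 or at distance 2 according to whether
  its syndrome is zero, in \<open>D\<close>, or elsewhere, and passing to a neighbor adds an element of \<open>D\<close> to the
  syndrome. So all parameters follow from the number of ways to move from a given syndrome into \<open>D\<close>
  by adding an element of \<open>D\<close>. For a syndrome outside \<open>D \<union> {0}\<close> there is one such move for each of
  the \<open>c (c - 1)\<close> ordered pairs \<open>i \<noteq> j\<close>, adding an element of \<open>V\<^sub>i\<close> to land in \<open>V\<^sub>j\<close>; for a syndrome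
  in \<open>V\<^sub>l\<close> there are \<open>|V\<^sub>l| - 2\<close> moves within \<open>V\<^sub>l\<close> and one for each of the \<open>(c - 1) (c - 2)\<close> pairs
  avoiding \<open>l\<close>.\<close>

section \<open>Hamming distance\<close>

lemma finite_carrier_vec: "finite (carrier_vec n :: 'a :: finite vec set)"
proof -
  have "carrier_vec n \<subseteq> vec n ` ({..<n} \<rightarrow>\<^sub>E (UNIV :: 'a set))"
  proof
    fix x :: "'a vec" assume x: "x \<in> carrier_vec n"
    have "x = vec n (restrict (($) x) {..<n})" using x by (intro eq_vecI) auto
    moreover have "restrict (($) x) {..<n} \<in> {..<n} \<rightarrow>\<^sub>E UNIV" by auto
    ultimately show "x \<in> vec n ` ({..<n} \<rightarrow>\<^sub>E UNIV)" by (rule image_eqI)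
  qed
  then show ?thesis by (rule finite_subset) (simp add: finite_PiE)
qed

lemma add_vec_eq_zero_iff:
  fixes x y :: "'a :: ab_group_add vec"
  assumes "x \<in> carrier_vec M" "y \<in> carrier_vec M"
  shows "x + y = 0\<^sub>v M \<longleftrightarrow> y = - x"
proof -
  have "x + y = 0\<^sub>v M \<longleftrightarrow> (\<forall>i < M. x $ i + y $ i = 0)"
    using assms by (auto simp: vec_eq_iff)
  also have "\<dots> \<longleftrightarrow> (\<forall>i < M. y $ i = - (x $ i))"
    by (simp add: eq_neg_iff_add_eq_0 add.commute)
  also have "\<dots> \<longleftrightarrow> y = - x" using assms by (auto simp: vec_eq_iff)
  finally show ?thesis .
qed

lemma add_vec_eq_add_vec_iff:
  fixes a b x y :: "'a :: ab_group_add vec"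
  assumes "a \<in> carrier_vec M" "b \<in> carrier_vec M" "x \<in> carrier_vec M" "y \<in> carrier_vec M"
  shows "y + a = x + b \<longleftrightarrow> b - a = y - x"
proof -
  have "y + a = x + b \<longleftrightarrow> (\<forall>i < M. y $ i + a $ i = x $ i + b $ i)"
    using assms by (auto simp: vec_eq_iff)
  also have "\<dots> \<longleftrightarrow> (\<forall>i < M. b $ i - a $ i = y $ i - x $ i)"
  proof -
    have "p + r = s + t \<longleftrightarrow> t - r = p - s" for p r s t :: 'a
      by (auto simp: diff_eq_eq eq_diff_eq algebra_simps)
    then show ?thesis by simp
  qed
  also have "\<dots> \<longleftrightarrow> b - a = y - x" using assms by (auto simp: vec_eq_iff)
  finally show ?thesis .
qed

lemma minus_vec_eq_zero_iff:
  fixes x y :: "'a :: ab_group_add vec"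
  assumes "x \<in> carrier_vec M" "y \<in> carrier_vec M"
  shows "x - y = 0\<^sub>v M \<longleftrightarrow> x = y"
proof -
  have "x - y = 0\<^sub>v M \<longleftrightarrow> (\<forall>i < M. x $ i - y $ i = 0)"
    using assms by (auto simp: vec_eq_iff)
  also have "\<dots> \<longleftrightarrow> x = y" using assms by (auto simp: vec_eq_iff)
  finally show ?thesis .
qed

lemma hamming_dist_carrier:
  assumes "x \<in> carrier_vec N"
  shows "hamming_dist x y = card {i. i < N \<and> x $ i \<noteq> y $ i}"
  using assms by (auto simp: hamming_dist_def)

lemma hamming_dist_sym:
  assumes "x \<in> carrier_vec N" "y \<in> carrier_vec N"
  shows "hamming_dist x y = hamming_dist y x"
proof -
  have "{i. i < N \<and> x $ i \<noteq> y $ i} = {i. i < N \<and> y $ i \<noteq> x $ i}" by auto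
  then show ?thesis using assms by (simp add: hamming_dist_carrier)
qed

lemma hamming_dist_eq_0_iff:
  assumes "x \<in> carrier_vec N" "y \<in> carrier_vec N"
  shows "hamming_dist x y = 0 \<longleftrightarrow> x = y"
  using assms by (auto simp: hamming_dist_carrier intro!: eq_vecI)

lemma hamming_dist_triangle:
  assumes "x \<in> carrier_vec N" "y \<in> carrier_vec N"
  shows "hamming_dist x z \<le> hamming_dist x y + hamming_dist y z"
proof -
  have "card {i. i < N \<and> x $ i \<noteq> z $ i}
      \<le> card ({i. i < N \<and> x $ i \<noteq> y $ i} \<union> {i. i < N \<and> y $ i \<noteq> z $ i})"
    by (intro card_mono) auto
  also have "\<dots> \<le> card {i. i < N \<and> x $ i \<noteq> y $ i} + card {i. i < N \<and> y $ i \<noteq> z $ i}"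
    by (rule card_Un_le)
  finally show ?thesis using assms by (simp add: hamming_dist_carrier)
qed

lemma hamming_dist_eq_1_iff:
  fixes x y :: "'a :: field vec"
  assumes x: "x \<in> carrier_vec N" and y: "y \<in> carrier_vec N"
  shows "hamming_dist x y = 1 \<longleftrightarrow> (\<exists>a j. a \<noteq> 0 \<and> j < N \<and> y = x + a \<cdot>\<^sub>v unit_vec N j)"
proof
  assume "hamming_dist x y = 1"
  then obtain j where j: "{i. i < N \<and> x $ i \<noteq> y $ i} = {j}"
    using x by (auto simp: hamming_dist_carrier card_1_singleton_iff)
  have neq: "j < N" "x $ j \<noteq> y $ j" using j by auto
  have eq: "x $ i = y $ i" if "i < N" "i \<noteq> j" for i using j that by auto
  have "y = x + (y $ j - x $ j) \<cdot>\<^sub>v unit_vec N j"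
    using x y neq eq by (intro eq_vecI) (auto simp: unit_vec_def)
  then show "\<exists>a j. a \<noteq> 0 \<and> j < N \<and> y = x + a \<cdot>\<^sub>v unit_vec N j"
    using neq by (metis right_minus_eq)
next
  assume "\<exists>a j. a \<noteq> 0 \<and> j < N \<and> y = x + a \<cdot>\<^sub>v unit_vec N j"
  then obtain a j where "a \<noteq> 0" "j < N" "y = x + a \<cdot>\<^sub>v unit_vec N j" by auto
  then have "{i. i < N \<and> x $ i \<noteq> y $ i} = {j}" using x by (auto split: if_splits)
  then show "hamming_dist x y = 1" using x by (simp add: hamming_dist_carrier)
qed

lemma hamming_dist_eq_Suc:
  assumes x: "x \<in> carrier_vec N" and y: "y \<in> carrier_vec N" and "hamming_dist x y = Suc r"
  obtains z where "z \<in> carrier_vec N" "hamming_dist x z = 1" "hamming_dist z y = r"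
proof -
  let ?S = "{i. i < N \<and> x $ i \<noteq> y $ i}"
  have card: "card ?S = Suc r" using assms by (simp add: hamming_dist_carrier)
  then have "?S \<noteq> {}" by (metis card.empty nat.distinct(1))
  then obtain j where j: "j < N" "x $ j \<noteq> y $ j" by auto
  define z where "z = vec N (\<lambda>i. if i = j then y $ i else x $ i)"
  have "{i. i < N \<and> x $ i \<noteq> z $ i} = {j}" "{i. i < N \<and> z $ i \<noteq> y $ i} = ?S - {j}"
    using j by (auto simp: z_def split: if_splits)
  moreover have "z \<in> carrier_vec N" by (simp add: z_def)
  ultimately show thesis using x j card by (intro that[of z]) (auto simp: hamming_dist_carrier)
qed

text \<open>A common neighbor must differ from \<open>x\<close> in the very coordinate in which
  \<open>z\<close> does, since otherwise it would be at distance 2 from \<open>z\<close>. That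
  coordinate takes any value except those of \<open>x\<close> and \<open>z\<close>.\<close>

lemma card_common_neighbors_1:
  fixes x z :: "'a :: {field, finite} vec"
  assumes x: "x \<in> carrier_vec N" and z: "z \<in> carrier_vec N" and "hamming_dist x z = 1"
  shows "card {y \<in> neighbors N x. hamming_dist y z = 1} = card (UNIV :: 'a set) - 2"
proof -
  obtain a j where a: "a \<noteq> 0" "j < N" "z = x + a \<cdot>\<^sub>v unit_vec N j"
    using assms hamming_dist_eq_1_iff by blast
  let ?f = "\<lambda>t. x + t \<cdot>\<^sub>v unit_vec N j"
  have inj: "inj_on ?f X" for X
  proof (rule inj_onI)
    fix s t assume "?f s = ?f t"
    then have "?f s $ j = ?f t $ j" by simp
    then show "s = t" using x a by simp
  qed
  have dist: "hamming_dist (?f t) z = 1 \<longleftrightarrow> t \<noteq> a" for t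
  proof -
    have "{i. i < N \<and> ?f t $ i \<noteq> z $ i} = (if t = a then {} else {j})"
      using a x by (auto split: if_splits)
    then show ?thesis using x by (subst hamming_dist_carrier[of _ N]) auto
  qed
  have "{y \<in> neighbors N x. hamming_dist y z = 1} = ?f ` (UNIV - {0, a})"
  proof (intro equalityI subsetI)
    fix y assume "y \<in> {y \<in> neighbors N x. hamming_dist y z = 1}"
    then have y: "y \<in> carrier_vec N" "hamming_dist x y = 1" "hamming_dist y z = 1"
      by (auto simp: neighbors_def)
    then obtain b i where b: "b \<noteq> 0" "i < N" "y = x + b \<cdot>\<^sub>v unit_vec N i"
      using hamming_dist_eq_1_iff[OF x] by blast
    have "i = j"
    proof (rule ccontr)
      assume "i \<noteq> j"
      then have "{l. l < N \<and> y $ l \<noteq> z $ l} = {i, j}"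
        using a b x by (auto split: if_splits)
      then show False using y \<open>i \<noteq> j\<close> by (simp add: hamming_dist_carrier)
    qed
    then show "y \<in> ?f ` (UNIV - {0, a})" using b y dist by auto
  next
    fix y assume "y \<in> ?f ` (UNIV - {0, a})"
    then obtain t where t: "t \<noteq> 0" "t \<noteq> a" "y = ?f t" by auto
    then have "hamming_dist x y = 1"
      using x a by (subst hamming_dist_eq_1_iff[OF x]) auto
    then show "y \<in> {y \<in> neighbors N x. hamming_dist y z = 1}"
      using t dist x by (auto simp: neighbors_def)
  qed
  then have "card {y \<in> neighbors N x. hamming_dist y z = 1} = card (UNIV - {0, a})"
    by (simp add: card_image inj)
  also have "\<dots> = card (UNIV :: 'a set) - 2"
    using a by (subst card_Diff_subset) auto
  finally show ?thesis .
qed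

text \<open>The two common neighbors arise by replacing one of the two differing coordinates of
  \<open>x\<close> by that of \<open>z\<close>.\<close>

lemma card_common_neighbors_2:
  assumes x: "x \<in> carrier_vec N" and z: "z \<in> carrier_vec N" and "hamming_dist x z = 2"
  shows "card {y \<in> neighbors N x. hamming_dist y z = 1} = 2"
proof -
  obtain i j where ij: "{l. l < N \<and> x $ l \<noteq> z $ l} = {i, j}" "i \<noteq> j"
    using assms by (auto simp: hamming_dist_carrier card_2_iff)
  then have lt: "i < N" "j < N" and neq: "x $ i \<noteq> z $ i" "x $ j \<noteq> z $ j" by auto
  have eq: "l = i \<or> l = j" if "x $ l \<noteq> z $ l" "l < N" for l using ij that by auto
  define f where "f m = vec N (\<lambda>l. if l = m then z $ l else x $ l)" for m
  have f: "f m \<in> carrier_vec N" for m by (simp add: f_def)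
  have "{y \<in> neighbors N x. hamming_dist y z = 1} = {f i, f j}"
  proof (intro equalityI subsetI)
    fix y assume "y \<in> {y \<in> neighbors N x. hamming_dist y z = 1}"
    then have y: "y \<in> carrier_vec N" "hamming_dist x y = 1" "hamming_dist y z = 1"
      by (auto simp: neighbors_def)
    obtain m where m: "{l. l < N \<and> x $ l \<noteq> y $ l} = {m}"
      using x y by (auto simp: hamming_dist_carrier card_1_singleton_iff)
    obtain p where p: "{l. l < N \<and> y $ l \<noteq> z $ l} = {p}"
      using y by (auto simp: hamming_dist_carrier card_1_singleton_iff)
    have "l \<in> {m, p}" if "l < N" "x $ l \<noteq> z $ l" for l
    proof (cases "x $ l = y $ l")
      case True
      then have "l \<in> {l. l < N \<and> y $ l \<noteq> z $ l}" using that by simp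
      then show ?thesis unfolding p by simp
    next
      case False
      then have "l \<in> {l. l < N \<and> x $ l \<noteq> y $ l}" using that by simp
      then show ?thesis unfolding m by simp
    qed
    then have sub: "{i, j} \<subseteq> {m, p}" using lt neq by simp
    then have mp: "m = i \<and> p = j \<or> m = j \<and> p = i" using \<open>i \<noteq> j\<close> by auto
    have "y $ l = (if l = m then z $ l else x $ l)" if "l < N" for l
    proof (cases "l = m")
      case True
      then have "l \<noteq> p" using mp ij(2) by auto
      then show ?thesis using p that True by auto
    next
      case False
      then have "l \<notin> {l. l < N \<and> x $ l \<noteq> y $ l}" unfolding m by simp
      then show ?thesis using that False by simp
    qed
    then have "y = f m" using y by (intro eq_vecI) (auto simp: f_def)
    then show "y \<in> {f i, f j}" using mp by auto
  next
    fix y assume y: "y \<in> {f i, f j}"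
    have "{l. l < N \<and> x $ l \<noteq> f i $ l} = {i}" "{l. l < N \<and> x $ l \<noteq> f j $ l} = {j}"
      "{l. l < N \<and> f i $ l \<noteq> z $ l} = {j}" "{l. l < N \<and> f j $ l \<noteq> z $ l} = {i}"
      using lt neq ij(2) by (auto simp: f_def dest: eq split: if_splits)
    then have "hamming_dist x (f i) = 1" "hamming_dist x (f j) = 1"
      "hamming_dist (f i) z = 1" "hamming_dist (f j) z = 1"
      using x f by (simp_all add: hamming_dist_carrier[of _ N])
    then show "y \<in> {y \<in> neighbors N x. hamming_dist y z = 1}"
      using y f unfolding neighbors_def by blast
  qed
  moreover have "f i \<noteq> f j"
  proof
    assume "f i = f j"
    then have "f i $ i = f j $ i" by simp
    then show False using lt neq ij(2) by (simp add: f_def)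
  qed
  ultimately show ?thesis by simp
qed

section \<open>Codes given by a parity check matrix\<close>

text \<open>The columns represent distinct points of a projective space. Injectivity includes the
  scalars, so that a nonzero multiple of a column determines both scalar and index, that is, a
  single-coordinate error.\<close>

locale projective_system =
  fixes P :: "'a :: {field, finite} mat" and M N :: nat
  assumes P_carrier: "P \<in> carrier_mat M N"
    and col_nonzero: "j < N \<Longrightarrow> col P j \<noteq> 0\<^sub>v M"
    and col_inj: "\<lbrakk>a \<noteq> 0; b \<noteq> 0; i < N; j < N; a \<cdot>\<^sub>v col P i = b \<cdot>\<^sub>v col P j\<rbrakk> \<Longrightarrow> a = b \<and> i = j"
begin

text \<open>The syndromes of the single-coordinate errors; for the matrix of the theorem this is the
  set \<open>D\<close> above.\<close>

definition multiples :: "'a vec set" where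
  "multiples = (\<lambda>(a, j). a \<cdot>\<^sub>v col P j) ` ((UNIV - {0}) \<times> {..<N})"

abbreviation code :: "'a vec set" where
  "code \<equiv> mat_kernel P"

lemma multiples_iff: "d \<in> multiples \<longleftrightarrow> (\<exists>a j. a \<noteq> 0 \<and> j < N \<and> d = a \<cdot>\<^sub>v col P j)"
  by (auto simp: multiples_def)

lemma col_carrier: "j < N \<Longrightarrow> col P j \<in> carrier_vec M"
  using P_carrier by auto

lemma multiples_carrier: "d \<in> multiples \<Longrightarrow> d \<in> carrier_vec M"
  using col_carrier by (auto simp: multiples_iff)

lemma zero_notin_multiples: "0\<^sub>v M \<notin> multiples"
proof
  assume "0\<^sub>v M \<in> multiples"
  then obtain a j where a: "a \<noteq> 0" "j < N" "a \<cdot>\<^sub>v col P j = 0\<^sub>v M"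
    by (auto simp: multiples_iff)
  have "inverse a \<cdot>\<^sub>v (a \<cdot>\<^sub>v col P j) = inverse a \<cdot>\<^sub>v 0\<^sub>v M" using a by simp
  moreover have "inverse a \<cdot>\<^sub>v (a \<cdot>\<^sub>v col P j) = col P j"
    using a(1) by (simp add: smult_smult_assoc)
  moreover have "inverse a \<cdot>\<^sub>v 0\<^sub>v M = 0\<^sub>v M" by (intro eq_vecI) auto
  ultimately have "col P j = 0\<^sub>v M" by metis
  then show False using col_nonzero a by simp
qed

lemma uminus_multiples: "d \<in> multiples \<Longrightarrow> - d \<in> multiples"
proof -
  assume "d \<in> multiples"
  then obtain a j where a: "a \<noteq> 0" "j < N" "d = a \<cdot>\<^sub>v col P j" by (auto simp: multiples_iff)
  then have "- d = (- a) \<cdot>\<^sub>v col P j" by (intro eq_vecI) auto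
  then show ?thesis using a unfolding multiples_iff by (metis neg_equal_0_iff_equal)
qed

lemma inj_multiples: "inj_on (\<lambda>(a, j). a \<cdot>\<^sub>v col P j) ((UNIV - {0}) \<times> {..<N})"
  using col_inj unfolding inj_on_def by simp

lemma card_multiples: "card multiples = (card (UNIV :: 'a set) - 1) * N"
  by (simp add: multiples_def card_image[OF inj_multiples] card_cartesian_product)

lemma finite_multiples: "finite multiples"
  by (simp add: multiples_def)

lemma unit_carrier: "x \<in> carrier_vec N \<Longrightarrow> x + a \<cdot>\<^sub>v unit_vec N j \<in> carrier_vec N"
  by auto

lemma mult_unit_vec: "j < N \<Longrightarrow> P *\<^sub>v unit_vec N j = col P j"
  using P_carrier by (intro eq_vecI) auto

lemma syndrome_step:
  assumes "x \<in> carrier_vec N" "j < N"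
  shows "P *\<^sub>v (x + a \<cdot>\<^sub>v unit_vec N j) = P *\<^sub>v x + a \<cdot>\<^sub>v col P j"
  using assms P_carrier
  by (simp add: mult_add_distrib_mat_vec[of _ M N] mult_mat_vec[of _ M N] mult_unit_vec)

lemma syndrome_carrier: "x \<in> carrier_vec N \<Longrightarrow> P *\<^sub>v x \<in> carrier_vec M"
  using P_carrier by auto

lemma code_iff: "x \<in> code \<longleftrightarrow> x \<in> carrier_vec N \<and> P *\<^sub>v x = 0\<^sub>v M"
  using P_carrier by (auto simp: mat_kernel_def)

lemma zero_in_code: "0\<^sub>v N \<in> code"
  using P_carrier by (auto simp: code_iff)

lemma finite_code: "finite code"
  using finite_carrier_vec by (rule finite_subset[rotated]) (auto simp: code_iff)

lemma neighbors_eq: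
  fixes x :: "'a vec"
  assumes "x \<in> carrier_vec N"
  shows "neighbors N x = (\<lambda>(a, j). x + a \<cdot>\<^sub>v unit_vec N j) ` ((UNIV - {0}) \<times> {..<N})"
proof -
  have "y \<in> neighbors N x \<longleftrightarrow> (\<exists>a j. a \<noteq> 0 \<and> j < N \<and> y = x + a \<cdot>\<^sub>v unit_vec N j)" for y
    using hamming_dist_eq_1_iff[OF assms, of y] unit_carrier[OF assms]
    unfolding neighbors_def by blast
  then show ?thesis unfolding set_eq_iff image_iff by (simp add: Bex_def split_def)
qed

text \<open>Neighbors of \<open>x\<close> and elements of \<open>multiples\<close> are both
  parametrized without repetition by the pairs \<open>(a, j)\<close> with
  \<open>a \<noteq> 0\<close>, and a step along such a pair adds \<open>a\<close> times column
  \<open>j\<close> to the syndrome. This turns counts of neighbors into counts of syndromes.\<close>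

lemma card_neighbors_filter:
  assumes x: "x \<in> carrier_vec N"
  shows "card {y \<in> neighbors N x. Q (P *\<^sub>v y)} = card {d \<in> multiples. Q (P *\<^sub>v x + d)}"
proof -
  let ?I = "{(a, j). (a :: 'a) \<noteq> 0 \<and> j < N \<and> Q (P *\<^sub>v x + a \<cdot>\<^sub>v col P j)}"
  have inj: "inj_on (\<lambda>(a, j). x + a \<cdot>\<^sub>v unit_vec N j) ?I"
  proof (rule inj_onI, clarify, rule ccontr)
    fix a i b j
    assume a: "a \<noteq> 0" "i < N" and b: "b \<noteq> 0" "j < N"
      and eq: "x + a \<cdot>\<^sub>v unit_vec N i = x + b \<cdot>\<^sub>v unit_vec N j" and neq: "\<not> (a = b \<and> i = j)"
    have "(x + a \<cdot>\<^sub>v unit_vec N i) $ i = (x + b \<cdot>\<^sub>v unit_vec N j) $ i" using eq by simp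
    then show False using x a b neq by (auto split: if_splits)
  qed
  have "{y \<in> neighbors N x. Q (P *\<^sub>v y)} = (\<lambda>(a, j). x + a \<cdot>\<^sub>v unit_vec N j) ` ?I"
    using x by (auto simp: neighbors_eq syndrome_step image_iff)
  then have "card {y \<in> neighbors N x. Q (P *\<^sub>v y)} = card ?I"
    by (simp add: card_image inj)
  also have "\<dots> = card ((\<lambda>(a, j). a \<cdot>\<^sub>v col P j) ` ?I)"
    by (intro card_image[symmetric] inj_on_subset[OF inj_multiples]) auto
  also have "(\<lambda>(a, j). a \<cdot>\<^sub>v col P j) ` ?I = {d \<in> multiples. Q (P *\<^sub>v x + d)}"
    by (auto simp: multiples_iff image_iff)
  finally show ?thesis .
qed

lemma dist_to_code_le_iff:
  "dist_to_code x code \<le> r \<longleftrightarrow> (\<exists>z \<in> code. hamming_dist x z \<le> r)"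
  unfolding dist_to_code_def using finite_code zero_in_code by (subst Min_le_iff) auto

lemma dist_to_code_eq_0_iff:
  assumes "x \<in> carrier_vec N"
  shows "dist_to_code x code = 0 \<longleftrightarrow> P *\<^sub>v x = 0\<^sub>v M"
proof -
  have "dist_to_code x code = 0 \<longleftrightarrow> (\<exists>z \<in> code. hamming_dist x z = 0)"
    using dist_to_code_le_iff[of x 0] by simp
  also have "\<dots> \<longleftrightarrow> x \<in> code"
    using assms by (auto simp: hamming_dist_eq_0_iff code_iff)
  finally show ?thesis using assms by (simp add: code_iff)
qed

lemma codeword_neighbor_iff:
  assumes x: "x \<in> carrier_vec N"
  shows "(\<exists>z \<in> code. hamming_dist x z = 1) \<longleftrightarrow> P *\<^sub>v x \<in> multiples"
proof
  assume "\<exists>z \<in> code. hamming_dist x z = 1"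
  then obtain z where z: "z \<in> carrier_vec N" "P *\<^sub>v z = 0\<^sub>v M" "hamming_dist x z = 1"
    by (auto simp: code_iff)
  then obtain a j where a: "a \<noteq> 0" "j < N" "z = x + a \<cdot>\<^sub>v unit_vec N j"
    using hamming_dist_eq_1_iff[OF x] by blast
  then have "P *\<^sub>v x + a \<cdot>\<^sub>v col P j = 0\<^sub>v M" using z x syndrome_step by simp
  then have "a \<cdot>\<^sub>v col P j = - (P *\<^sub>v x)"
    using add_vec_eq_zero_iff[OF syndrome_carrier[OF x]] col_carrier[OF a(2)] by simp
  then have "- (P *\<^sub>v x) \<in> multiples" using a unfolding multiples_iff by metis
  from uminus_multiples[OF this] show "P *\<^sub>v x \<in> multiples" by simp
next
  assume "P *\<^sub>v x \<in> multiples"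
  then obtain a j where a: "a \<noteq> 0" "j < N" "P *\<^sub>v x = a \<cdot>\<^sub>v col P j" by (auto simp: multiples_iff)
  have "P *\<^sub>v (x + (- a) \<cdot>\<^sub>v unit_vec N j) = 0\<^sub>v M"
    using P_carrier a(2)
    by (subst syndrome_step[OF x a(2)], subst a(3), intro eq_vecI) auto
  then have "x + (- a) \<cdot>\<^sub>v unit_vec N j \<in> code" using x by (simp add: code_iff)
  moreover have "hamming_dist x (x + (- a) \<cdot>\<^sub>v unit_vec N j) = 1"
    using a x by (subst hamming_dist_eq_1_iff[OF x]) (auto intro!: exI[of _ "- a"])
  ultimately show "\<exists>z \<in> code. hamming_dist x z = 1" by blast
qed

lemma dist_to_code_eq_1_iff:
  assumes x: "x \<in> carrier_vec N"
  shows "dist_to_code x code = 1 \<longleftrightarrow> P *\<^sub>v x \<in> multiples"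
proof -
  have "dist_to_code x code = 1 \<longleftrightarrow> dist_to_code x code \<le> 1 \<and> dist_to_code x code \<noteq> 0" by auto
  also have "\<dots> \<longleftrightarrow> (\<exists>z \<in> code. hamming_dist x z = 1) \<and> dist_to_code x code \<noteq> 0"
    using dist_to_code_le_iff[of x 1] dist_to_code_le_iff[of x 0]
    by (metis One_nat_def le_Suc_eq le_zero_eq)
  also have "\<dots> \<longleftrightarrow> P *\<^sub>v x \<in> multiples"
    using codeword_neighbor_iff[OF x] dist_to_code_eq_0_iff[OF x] zero_notin_multiples by metis
  finally show ?thesis .
qed

text \<open>Two codewords at distance 2 would have a common neighbor \<open>z\<close>. Each of them
  gives the syndrome of \<open>z\<close> as a multiple of a column, so both steps to
  \<open>z\<close> coincide and the codewords agree. Distance 1 would make zero a nonzero multiple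
  of a column.\<close>

lemma codeword_dist_ge_3:
  assumes x: "x \<in> code" and y: "y \<in> code" and "x \<noteq> y"
  shows "hamming_dist x y \<ge> 3"
proof (rule ccontr)
  assume "\<not> hamming_dist x y \<ge> 3"
  then have "hamming_dist x y = 0 \<or> hamming_dist x y = 1 \<or> hamming_dist x y = Suc 1" by auto
  moreover have xc: "x \<in> carrier_vec N" "P *\<^sub>v x = 0\<^sub>v M" and yc: "y \<in> carrier_vec N" "P *\<^sub>v y = 0\<^sub>v M"
    using x y by (auto simp: code_iff)
  moreover have "hamming_dist x y \<noteq> 0" using assms xc yc by (simp add: hamming_dist_eq_0_iff)
  moreover have "hamming_dist x y \<noteq> 1"
    using codeword_neighbor_iff[OF xc(1)] y xc zero_notin_multiples by auto
  ultimately have d: "hamming_dist x y = Suc 1" by simp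
  obtain z where z: "z \<in> carrier_vec N" "hamming_dist x z = 1" "hamming_dist z y = 1"
    using hamming_dist_eq_Suc[OF xc(1) yc(1) d] by metis
  then have "hamming_dist y z = 1" using hamming_dist_sym[OF z(1) yc(1)] by simp
  then obtain b j where b: "b \<noteq> 0" "j < N" "z = y + b \<cdot>\<^sub>v unit_vec N j"
    using hamming_dist_eq_1_iff[OF yc(1) z(1)] by blast
  obtain a i where a: "a \<noteq> 0" "i < N" "z = x + a \<cdot>\<^sub>v unit_vec N i"
    using hamming_dist_eq_1_iff[OF xc(1) z(1)] z(2) by blast
  have "P *\<^sub>v z = a \<cdot>\<^sub>v col P i" "P *\<^sub>v z = b \<cdot>\<^sub>v col P j"
    using syndrome_step[OF xc(1) a(2), of a] syndrome_step[OF yc(1) b(2), of b] a b xc yc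
      col_carrier by auto
  then have "a = b" "i = j" using col_inj[OF a(1) b(1) a(2) b(2)] by auto
  then have eq: "x + a \<cdot>\<^sub>v unit_vec N i = y + a \<cdot>\<^sub>v unit_vec N i" using a b by simp
  have "x = y"
  proof (rule eq_vecI)
    fix l assume l: "l < dim_vec y"
    have "(x + a \<cdot>\<^sub>v unit_vec N i) $ l = (y + a \<cdot>\<^sub>v unit_vec N i) $ l" using eq by simp
    then show "x $ l = y $ l" using l xc yc a by simp
  qed (use xc yc in auto)
  then show False using \<open>x \<noteq> y\<close> by simp
qed

lemma subspace_code: "subvectorspace N code"
proof -
  interpret vec_space "TYPE('a)" N .
  have "submodule class_ring code (module_vec TYPE('a) N)"
    using P_carrier mat_kernel_smult[OF P_carrier]
    by (unfold_locales)
      (auto simp: module_vec_simps code_iff mult_add_distrib_mat_vec[of _ M N])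
  then show ?thesis unfolding subspace_def using vectorspace_axioms by simp
qed

end

text \<open>\<open>sums_cover\<close> bounds the covering radius by 2, \<open>not_cover\<close>
  makes the layer at distance 2 nonempty, and \<open>collinear\<close> yields a codeword of weight
  3. The two counts determine the intersection numbers.\<close>

locale two_layer_code = projective_system +
  fixes A\<^sub>1 A\<^sub>2 :: nat
  assumes sums_cover:
      "\<lbrakk>w \<in> carrier_vec M; w \<noteq> 0\<^sub>v M; w \<notin> multiples\<rbrakk> \<Longrightarrow> \<exists>d \<in> multiples. w + d \<in> multiples"
    and not_cover: "\<exists>w \<in> carrier_vec M. w \<noteq> 0\<^sub>v M \<and> w \<notin> multiples"
    and collinear: "\<exists>i j. i < N \<and> j < N \<and> i \<noteq> j \<and> col P i + col P j \<in> multiples"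
    and count_1: "w \<in> multiples \<Longrightarrow> card {d \<in> multiples. w + d \<in> multiples} = A\<^sub>1"
    and count_2: "\<lbrakk>w \<in> carrier_vec M; w \<noteq> 0\<^sub>v M; w \<notin> multiples\<rbrakk>
      \<Longrightarrow> card {d \<in> multiples. w + d \<in> multiples} = A\<^sub>2"
begin

text \<open>A multiple of a column is the syndrome of a scaled unit vector, and by
  \<open>sums_cover\<close> any other nonzero \<open>w\<close> is a difference of two such
  multiples.\<close>

lemma surj_syndrome:
  assumes w: "w \<in> carrier_vec M"
  obtains x where "x \<in> carrier_vec N" "P *\<^sub>v x = w"
proof -
  have mult: "\<exists>x \<in> carrier_vec N. P *\<^sub>v x = d" if d: "d \<in> multiples" for d
  proof -
    obtain a j where "j < N" "d = a \<cdot>\<^sub>v col P j" using d unfolding multiples_iff by blast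
    then have "P *\<^sub>v (a \<cdot>\<^sub>v unit_vec N j) = d"
      using P_carrier by (simp add: mult_mat_vec[of _ M N] mult_unit_vec)
    then show ?thesis by (intro bexI[of _ "a \<cdot>\<^sub>v unit_vec N j"]) auto
  qed
  have "\<exists>x \<in> carrier_vec N. P *\<^sub>v x = w"
  proof (cases "w = 0\<^sub>v M \<or> w \<in> multiples")
    case True
    then show ?thesis using mult zero_in_code by (auto simp: code_iff)
  next
    case False
    then obtain d where d: "d \<in> multiples" "w + d \<in> multiples" using sums_cover w by blast
    then obtain x y where x: "x \<in> carrier_vec N" "P *\<^sub>v x = d"
      and y: "y \<in> carrier_vec N" "P *\<^sub>v y = w + d" using mult by metis
    have "P *\<^sub>v (y - x) = P *\<^sub>v y - P *\<^sub>v x"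
      using x y P_carrier by (intro mult_minus_distrib_mat_vec) auto
    also have "\<dots> = w"
      using x(2) y(2) w multiples_carrier[OF d(1)] by (intro eq_vecI) auto
    finally show ?thesis using x y by (intro bexI[of _ "y - x"]) auto
  qed
  then show thesis using that by blast
qed

lemma dist_to_code_le_2:
  assumes x: "x \<in> carrier_vec N"
  shows "dist_to_code x code \<le> 2"
proof (cases "P *\<^sub>v x = 0\<^sub>v M \<or> P *\<^sub>v x \<in> multiples")
  case True
  then show ?thesis using dist_to_code_eq_0_iff[OF x] dist_to_code_eq_1_iff[OF x] by auto
next
  case False
  then obtain d where d: "d \<in> multiples" "P *\<^sub>v x + d \<in> multiples"
    using sums_cover syndrome_carrier[OF x] by blast
  then obtain a j where a: "a \<noteq> 0" "j < N" "d = a \<cdot>\<^sub>v col P j" by (auto simp: multiples_iff)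
  let ?y = "x + a \<cdot>\<^sub>v unit_vec N j"
  have y: "?y \<in> carrier_vec N" using x by simp
  have "P *\<^sub>v ?y \<in> multiples" using syndrome_step[OF x a(2)] d a by simp
  then obtain z where z: "z \<in> code" "hamming_dist ?y z = 1"
    using codeword_neighbor_iff[OF y] by blast
  have "hamming_dist x ?y = 1" using hamming_dist_eq_1_iff[OF x y] a by blast
  then have "hamming_dist x z \<le> 2" using hamming_dist_triangle[OF x y, of z] z by simp
  then show ?thesis using z dist_to_code_le_iff by blast
qed

lemma dist_to_code_eq_2_iff:
  assumes x: "x \<in> carrier_vec N"
  shows "dist_to_code x code = 2 \<longleftrightarrow> P *\<^sub>v x \<noteq> 0\<^sub>v M \<and> P *\<^sub>v x \<notin> multiples"
  using dist_to_code_le_2[OF x] dist_to_code_eq_0_iff[OF x] dist_to_code_eq_1_iff[OF x] by linarith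

lemma covering_radius_code: "covering_radius N code = 2"
proof -
  obtain w where w: "w \<in> carrier_vec M" "w \<noteq> 0\<^sub>v M" "w \<notin> multiples" using not_cover by blast
  obtain x where x: "x \<in> carrier_vec N" "P *\<^sub>v x = w" using surj_syndrome[OF w(1)] by blast
  have "dist_to_code x code = 2" using dist_to_code_eq_2_iff[OF x(1)] x w by simp
  then show ?thesis
    unfolding covering_radius_def using x dist_to_code_le_2
    by (intro Max_eqI) (auto simp: finite_carrier_vec)
qed

text \<open>A relation \<open>h_i + h_j = a h_l\<close> among columns makes
  \<open>e_i + e_j - a e_l\<close> a codeword. It is nonzero with at most three nonzero coordinates,
  hence of weight 3 by the lower bound.\<close>

lemma min_distance_code: "min_distance code = 3"
proof -
  let ?S = "{hamming_dist x y | x y. x \<in> code \<and> y \<in> code \<and> x \<noteq> y}"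
  have "?S \<subseteq> (\<lambda>(x, y). hamming_dist x y) ` (code \<times> code)" by auto
  then have fin: "finite ?S" by (rule finite_subset) (simp add: finite_code)
  obtain i j where ij: "i < N" "j < N" "i \<noteq> j" "col P i + col P j \<in> multiples"
    using collinear by blast
  then obtain a l where l: "a \<noteq> 0" "l < N" "col P i + col P j = a \<cdot>\<^sub>v col P l"
    by (auto simp: multiples_iff)
  \<comment> \<open>The scalar 1 gives the sum the form of a single step, to which
    \<open>syndrome_step\<close> applies.\<close>
  define z\<^sub>2 :: "'a vec" where "z\<^sub>2 = unit_vec N i + 1 \<cdot>\<^sub>v unit_vec N j"
  define z where "z = z\<^sub>2 + (- a) \<cdot>\<^sub>v unit_vec N l"
  have z2c: "z\<^sub>2 \<in> carrier_vec N" by (simp add: z\<^sub>2_def)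
  have zc: "z \<in> carrier_vec N" unfolding z_def by (rule unit_carrier[OF z2c])
  have "P *\<^sub>v z\<^sub>2 = col P i + 1 \<cdot>\<^sub>v col P j"
    unfolding z\<^sub>2_def by (subst syndrome_step) (simp_all only: unit_vec_carrier ij mult_unit_vec)
  then have "P *\<^sub>v z = col P i + 1 \<cdot>\<^sub>v col P j + (- a) \<cdot>\<^sub>v col P l"
    unfolding z_def by (simp only: syndrome_step[OF z2c l(2)])
  also have "\<dots> = (col P i + col P j) + (- a) \<cdot>\<^sub>v col P l"
    using P_carrier ij by (intro eq_vecI) auto
  also have "\<dots> = 0\<^sub>v M" unfolding l(3) using P_carrier l(2) by (intro eq_vecI) auto
  finally have z: "z \<in> code" using zc by (simp add: code_iff)
  have "z \<noteq> 0\<^sub>v N"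
  proof
    assume "z = 0\<^sub>v N"
    then have "z $ i = 0" "z $ j = 0" using ij by auto
    then have "l = i" "l = j" using ij l by (auto simp: z_def z\<^sub>2_def split: if_splits)
    then show False using ij by simp
  qed
  then have ge: "hamming_dist (0\<^sub>v N) z \<ge> 3" using codeword_dist_ge_3[OF zero_in_code z] by auto
  have "{m. m < N \<and> 0\<^sub>v N $ m \<noteq> z $ m} \<subseteq> {i, j, l}"
    using ij l by (auto simp: z_def z\<^sub>2_def split: if_splits)
  then have "card {m. m < N \<and> 0\<^sub>v N $ m \<noteq> z $ m} \<le> card {i, j, l}" by (intro card_mono) auto
  also have "\<dots> \<le> 3" by (simp add: card_insert_if)
  finally have "hamming_dist (0\<^sub>v N) z = 3" using ge by (simp add: hamming_dist_carrier[of _ N])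
  then have "3 \<in> ?S" unfolding mem_Collect_eq
    using z zero_in_code \<open>z \<noteq> 0\<^sub>v N\<close> by metis
  then show ?thesis unfolding min_distance_def
    by (intro Min_eqI fin) (auto intro: codeword_dist_ge_3)
qed

lemma packing_radius_code: "packing_radius code = 1"
  by (simp add: packing_radius_def min_distance_code)

lemma quasi_perfect_code: "quasi_perfect N code"
  by (simp add: quasi_perfect_def packing_radius_code covering_radius_code)

lemma neighbors_carrier: "y \<in> neighbors N x \<Longrightarrow> y \<in> carrier_vec N"
  by (simp add: neighbors_def)

lemma finite_neighbors: "finite (neighbors N (x :: 'a vec))"
  by (rule finite_subset[OF _ finite_carrier_vec[of N]]) (auto simp: neighbors_def)

lemma card_neighbors:
  fixes x :: "'a vec"
  assumes x: "x \<in> carrier_vec N"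
  shows "card (neighbors N x) = (card (UNIV :: 'a set) - 1) * N"
  using card_neighbors_filter[OF x, of "\<lambda>_. True"] by (simp add: card_multiples)

lemma card_neighbors_layer_1:
  assumes x: "x \<in> carrier_vec N"
  shows "card {y \<in> neighbors N x. dist_to_code y code = 1}
    = card {d \<in> multiples. P *\<^sub>v x + d \<in> multiples}"
proof -
  have "{y \<in> neighbors N x. dist_to_code y code = 1} = {y \<in> neighbors N x. P *\<^sub>v y \<in> multiples}"
    using dist_to_code_eq_1_iff neighbors_carrier by blast
  then show ?thesis using card_neighbors_filter[OF x] by simp
qed

lemma card_neighbors_layer_0:
  assumes x: "x \<in> carrier_vec N" and Px: "P *\<^sub>v x \<in> multiples"
  shows "card {y \<in> neighbors N x. dist_to_code y code = 0} = 1"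
proof -
  have "{y \<in> neighbors N x. dist_to_code y code = 0} = {y \<in> neighbors N x. P *\<^sub>v y = 0\<^sub>v M}"
    using dist_to_code_eq_0_iff neighbors_carrier by blast
  moreover have "{d \<in> multiples. P *\<^sub>v x + d = 0\<^sub>v M} = {- (P *\<^sub>v x)}"
    using add_vec_eq_zero_iff[OF syndrome_carrier[OF x]] multiples_carrier uminus_multiples[OF Px]
    by blast
  ultimately show ?thesis using card_neighbors_filter[OF x, of "\<lambda>s. s = 0\<^sub>v M"] by simp
qed

text \<open>For \<open>l = 1\<close> the only move into the code is minus the syndrome, and
  \<open>b\<close> is what remains of all neighbors after removing this one and the
  \<open>A\<^sub>1\<close> in the same layer. For \<open>l = 2\<close> the moves into layer 1 are
  counted by \<open>A\<^sub>2\<close>.\<close>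

lemma intersection_numbers_code:
  "intersection_numbers N code
    (\<lambda>l. if l = 0 then (card (UNIV :: 'a set) - 1) * N
         else if l = 1 then (card (UNIV :: 'a set) - 1) * N - 1 - A\<^sub>1 else 0)
    (\<lambda>l. if l = 0 then 0 else if l = 1 then 1 else A\<^sub>2)"
  unfolding intersection_numbers_def covering_radius_code
proof (intro allI impI ballI)
  fix l x assume "l \<le> 2" "x \<in> layer N code l"
  then have x: "x \<in> carrier_vec N" and l: "dist_to_code x code = l" by (auto simp: layer_def)
  have dy: "dist_to_code y code \<le> 2" if "y \<in> neighbors N x" for y
    using that neighbors_carrier dist_to_code_le_2 by blast
  let ?d = "\<lambda>y. dist_to_code y code"
  have d012: "?d y = 0 \<or> ?d y = 1 \<or> ?d y = 2" if "y \<in> neighbors N x" for y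
    using dy[OF that] by linarith
  consider "l = 0" | "l = 1" | "l = 2" using \<open>l \<le> 2\<close> by linarith
  then show "card {y \<in> neighbors N x. Suc (?d y) = l} = (if l = 0 then 0 else if l = 1 then 1 else A\<^sub>2)
    \<and> card {y \<in> neighbors N x. ?d y = Suc l} = (if l = 0 then (card (UNIV :: 'a set) - 1) * N
         else if l = 1 then (card (UNIV :: 'a set) - 1) * N - 1 - A\<^sub>1 else 0)"
  proof cases
    case 1
    then have Px: "P *\<^sub>v x = 0\<^sub>v M" using l dist_to_code_eq_0_iff[OF x] by simp
    have "{d \<in> multiples. P *\<^sub>v x + d \<in> multiples} = multiples"
      using Px multiples_carrier by auto
    then show ?thesis using 1 card_neighbors_layer_1[OF x] by (simp add: card_multiples)
  next
    case 2
    then have Px: "P *\<^sub>v x \<in> multiples" using l dist_to_code_eq_1_iff[OF x] by simp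
    have "neighbors N x = {y \<in> neighbors N x. ?d y = 0} \<union> ({y \<in> neighbors N x. ?d y = 1}
        \<union> {y \<in> neighbors N x. ?d y = 2})" using d012 by blast
    then have "card (neighbors N x) = card ({y \<in> neighbors N x. ?d y = 0} \<union> ({y \<in> neighbors N x. ?d y = 1}
        \<union> {y \<in> neighbors N x. ?d y = 2}))" by simp
    also have "\<dots> = card {y \<in> neighbors N x. ?d y = 0} + (card {y \<in> neighbors N x. ?d y = 1}
        + card {y \<in> neighbors N x. ?d y = 2})"
      using finite_neighbors by (subst card_Un_disjoint, simp, simp, force)+ simp
    finally have "(card (UNIV :: 'a set) - 1) * N = 1 + (A\<^sub>1 + card {y \<in> neighbors N x. ?d y = 2})"
      using card_neighbors_layer_1[OF x] card_neighbors_layer_0[OF x Px] card_neighbors[OF x]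
        count_1[OF Px] by simp
    then show ?thesis using 2 card_neighbors_layer_0[OF x Px] by (simp add: numeral_2_eq_2)
  next
    case 3
    then have Px: "P *\<^sub>v x \<noteq> 0\<^sub>v M" "P *\<^sub>v x \<notin> multiples" using l dist_to_code_eq_2_iff[OF x] by auto
    have none: "{y \<in> neighbors N x. ?d y = Suc 2} = {}" using dy by force
    have "{y \<in> neighbors N x. Suc (?d y) = 2} = {y \<in> neighbors N x. ?d y = 1}" by auto
    then show ?thesis unfolding 3 none
      using card_neighbors_layer_1[OF x] count_2[OF syndrome_carrier[OF x] Px] by simp
  qed
qed

section \<open>Codewords at distance 2 and uniform packing\<close>

lemma unique_codeword_neighbor:
  assumes y: "y \<in> carrier_vec N" "P *\<^sub>v y \<in> multiples"
  shows "\<exists>!z. z \<in> code \<and> hamming_dist y z = 1"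
proof (rule ex_ex1I)
  show "\<exists>z. z \<in> code \<and> hamming_dist y z = 1" using codeword_neighbor_iff[OF y(1)] y(2) by blast
next
  fix z z' assume z: "z \<in> code \<and> hamming_dist y z = 1" and z': "z' \<in> code \<and> hamming_dist y z' = 1"
  then have c: "z \<in> carrier_vec N" "z' \<in> carrier_vec N" by (auto simp: code_iff)
  \<comment> \<open>Two codewords next to \<open>y\<close> are closer to each other than the minimum
    distance.\<close>
  have "hamming_dist z z' \<le> 2"
    using hamming_dist_triangle[OF c(1) y(1), of z'] hamming_dist_sym[OF c(1) y(1)] z z' by simp
  then show "z = z'" using codeword_dist_ge_3[of z z'] z z' by force
qed

text \<open>Each codeword at distance 2 from \<open>x\<close> has exactly two common neighbors with \<open>x\<close>, while a vector
  next to the code has only one codeword next to it. Hence the codewords at distance 2 from \<open>x\<close>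
  are counted, twice each, by those neighbors of \<open>x\<close> next to the code whose codeword is not itself next
  to \<open>x\<close>.\<close>

lemma card_codewords_dist_2:
  assumes x: "x \<in> carrier_vec N" "x \<notin> code"
  shows "2 * card {z \<in> code. hamming_dist x z = 2}
    = card {d \<in> multiples. P *\<^sub>v x + d \<in> multiples}
      - card {y \<in> neighbors N x. \<exists>z \<in> code. hamming_dist x z = 1 \<and> hamming_dist y z = 1}"
proof -
  let ?Z = "{z \<in> code. hamming_dist x z = 2}"
  let ?B = "{y \<in> neighbors N x. \<exists>z \<in> code. hamming_dist x z = 1 \<and> hamming_dist y z = 1}"
  let ?Y = "{y \<in> neighbors N x. dist_to_code y code = 1}"
  have near: "dist_to_code y code = 1 \<longleftrightarrow> (\<exists>z \<in> code. hamming_dist y z = 1)"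
    if "y \<in> carrier_vec N" for y
    using dist_to_code_eq_1_iff[OF that] codeword_neighbor_iff[OF that] by simp
  have uniq: "z = z'" if "y \<in> carrier_vec N" "z \<in> code" "z' \<in> code" "hamming_dist y z = 1"
    "hamming_dist y z' = 1" for y z z'
    using unique_codeword_neighbor[OF that(1)] codeword_neighbor_iff[OF that(1)] that by blast
  have sub: "?B \<subseteq> ?Y" using near neighbors_carrier by blast
  have "?Y - ?B = (\<Union>z \<in> ?Z. {y \<in> neighbors N x. hamming_dist y z = 1})"
  proof (intro equalityI subsetI)
    fix y assume y: "y \<in> ?Y - ?B"
    then have yN: "y \<in> neighbors N x" and yc: "y \<in> carrier_vec N" using neighbors_carrier by auto
    obtain z where z: "z \<in> code" "hamming_dist y z = 1" using y near[OF yc] by blast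
    have "hamming_dist x z \<le> 2"
      using hamming_dist_triangle[OF x(1) yc, of z] z yN by (simp add: neighbors_def)
    moreover have "hamming_dist x z \<noteq> 0"
      using x z hamming_dist_eq_0_iff[OF x(1)] by (auto simp: code_iff)
    moreover have "hamming_dist x z \<noteq> 1" using y z by blast
    ultimately have "hamming_dist x z = 2" by linarith
    then show "y \<in> (\<Union>z \<in> ?Z. {y \<in> neighbors N x. hamming_dist y z = 1})" using z yN by blast
  next
    fix y assume "y \<in> (\<Union>z \<in> ?Z. {y \<in> neighbors N x. hamming_dist y z = 1})"
    then obtain z where z: "z \<in> code" "hamming_dist x z = 2" "hamming_dist y z = 1"
      and yN: "y \<in> neighbors N x" by auto
    have yc: "y \<in> carrier_vec N" using yN neighbors_carrier by blast
    have "hamming_dist x z' \<noteq> 1" if "z' \<in> code" "hamming_dist y z' = 1" for z'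
      using uniq[OF yc z(1) that(1) z(3) that(2)] z(2) by auto
    then show "y \<in> ?Y - ?B" using yN z near[OF yc] by blast
  qed
  then have "card (?Y - ?B) = card (\<Union>z \<in> ?Z. {y \<in> neighbors N x. hamming_dist y z = 1})" by simp
  also have "\<dots> = (\<Sum>z \<in> ?Z. card {y \<in> neighbors N x. hamming_dist y z = 1})"
  proof (rule card_UN_disjoint)
    show "finite ?Z" using finite_code by simp
    show "\<forall>z \<in> ?Z. finite {y \<in> neighbors N x. hamming_dist y z = 1}" using finite_neighbors by simp
    show "\<forall>z \<in> ?Z. \<forall>z' \<in> ?Z. z \<noteq> z' \<longrightarrow> {y \<in> neighbors N x. hamming_dist y z = 1}
      \<inter> {y \<in> neighbors N x. hamming_dist y z' = 1} = {}"
      using uniq neighbors_carrier by blast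
  qed
  also have "\<dots> = (\<Sum>z \<in> ?Z. 2)"
    using card_common_neighbors_2[OF x(1)] by (intro sum.cong) (simp_all add: code_iff)
  also have "\<dots> = 2 * card ?Z" by simp
  finally have "2 * card ?Z = card (?Y - ?B)" by simp
  also have "\<dots> = card ?Y - card ?B"
    using sub finite_neighbors by (intro card_Diff_subset) (auto intro: finite_subset)
  finally show ?thesis using card_neighbors_layer_1[OF x(1)] by simp
qed

text \<open>For \<open>x\<close> at distance 1 the neighbors to be subtracted are the
  \<open>q - 2\<close> common neighbors of \<open>x\<close> and the only codeword next to it; for
  \<open>x\<close> at distance 2 there are none. The two constants are thus
  \<open>(A\<^sub>1 - (q - 2)) div 2\<close> and \<open>A\<^sub>2 div 2\<close>.\<close>

lemma uniformly_packed_code: "uniformly_packed N code"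
proof -
  have "card {z \<in> code. hamming_dist x z = 2} = (A\<^sub>1 - (card (UNIV :: 'a set) - 2)) div 2"
    if x: "x \<in> carrier_vec N" and d: "dist_to_code x code = 1" for x
  proof -
    have Px: "P *\<^sub>v x \<in> multiples" using d dist_to_code_eq_1_iff[OF x] by simp
    then have "x \<notin> code" using zero_notin_multiples by (auto simp: code_iff)
    obtain z where z: "z \<in> code" "hamming_dist x z = 1"
      and uniq: "\<And>z'. z' \<in> code \<Longrightarrow> hamming_dist x z' = 1 \<Longrightarrow> z' = z"
      using unique_codeword_neighbor[OF x Px] by blast
    have "{y \<in> neighbors N x. \<exists>z \<in> code. hamming_dist x z = 1 \<and> hamming_dist y z = 1}
      = {y \<in> neighbors N x. hamming_dist y z = 1}" using z uniq by blast
    moreover have "z \<in> carrier_vec N" using z by (simp add: code_iff)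
    ultimately show ?thesis
      using card_codewords_dist_2[OF x \<open>x \<notin> code\<close>] count_1[OF Px]
        card_common_neighbors_1[OF x _ z(2)] by simp
  qed
  moreover have "card {z \<in> code. hamming_dist x z = 2} = A\<^sub>2 div 2"
    if x: "x \<in> carrier_vec N" and d: "dist_to_code x code = 2" for x
  proof -
    have Px: "P *\<^sub>v x \<noteq> 0\<^sub>v M" "P *\<^sub>v x \<notin> multiples" using d dist_to_code_eq_2_iff[OF x] by auto
    then have "x \<notin> code" by (simp add: code_iff)
    have none: "{y \<in> neighbors N x. \<exists>z \<in> code. hamming_dist x z = 1 \<and> hamming_dist y z = 1} = {}"
      using codeword_neighbor_iff[OF x] Px by blast
    show ?thesis
      using card_codewords_dist_2[OF x \<open>x \<notin> code\<close>] count_2[OF syndrome_carrier[OF x] Px]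
      unfolding none by simp
  qed
  ultimately show ?thesis
    unfolding uniformly_packed_def packing_radius_code one_add_one
    using quasi_perfect_code by blast
qed

text \<open>Rank-nullity for the syndrome map, which is onto by \<open>surj_syndrome\<close>. The
  additive form avoids truncated subtraction.\<close>

lemma dim_code: "subspace_dim N code + M = N"
proof -
  let ?V = "module_vec TYPE('a) N" and ?W = "module_vec TYPE('a) M"
  have hom: "mod_hom class_ring ?V ?W (\<lambda>x. P *\<^sub>v x)"
    using P_carrier syndrome_carrier
    by (intro mod_hom.intro vec_module mod_hom_axioms.intro)
      (auto simp: LinearCombinations.module_hom_def module_vec_simps
        mult_add_distrib_mat_vec[of _ M N] mult_mat_vec[of _ M N])
  then have lin: "linear_map class_ring ?V ?W (\<lambda>x. P *\<^sub>v x)"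
    by (intro linear_map.intro vec_vs)
  have "mod_hom.ker ?V ?W (\<lambda>x. P *\<^sub>v x) = code"
    unfolding mod_hom.ker_def[OF hom] by (auto simp: module_vec_simps code_iff)
  moreover have "mod_hom.im ?V (\<lambda>x. P *\<^sub>v x) = carrier_vec M"
  proof
    show "mod_hom.im ?V (\<lambda>x. P *\<^sub>v x) \<subseteq> carrier_vec M"
      unfolding mod_hom.im_def[OF hom] using syndrome_carrier by (auto simp: module_vec_simps)
    show "carrier_vec M \<subseteq> mod_hom.im ?V (\<lambda>x. P *\<^sub>v x)"
      unfolding mod_hom.im_def[OF hom] module_vec_simps
      using surj_syndrome by (metis image_eqI subsetI)
  qed
  moreover have "?W\<lparr>carrier := carrier_vec M\<rparr> = ?W" by (simp add: module_vec_def)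
  ultimately show ?thesis
    using linear_map.rank_nullity[OF lin vec_space.fin_dim]
    by (simp add: vec_space.dim_is_n)
qed

end

section \<open>Partial spreads\<close>

text \<open>\<open>complement\<close> expresses that \<open>V i\<close> and \<open>V j\<close> are
  complementary as additive groups: each \<open>w\<close> is uniquely an element of
  \<open>V j\<close> minus one of \<open>V i\<close>. It is phrased as a move \<open>v\<close> from
  \<open>w\<close>, as needed in the counts.\<close>

locale partial_spread =
  fixes M m :: nat and I :: "'i set" and V :: "'i \<Rightarrow> 'a :: {field, finite} vec set"
  assumes finite_I: "finite I"
    and V_carrier: "i \<in> I \<Longrightarrow> V i \<subseteq> carrier_vec M"
    and V_zero: "i \<in> I \<Longrightarrow> 0\<^sub>v M \<in> V i"
    and V_add: "\<lbrakk>i \<in> I; u \<in> V i; v \<in> V i\<rbrakk> \<Longrightarrow> u + v \<in> V i"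
    and V_uminus: "\<lbrakk>i \<in> I; v \<in> V i\<rbrakk> \<Longrightarrow> - v \<in> V i"
    and card_V: "i \<in> I \<Longrightarrow> card (V i) = m"
    and complement: "\<lbrakk>i \<in> I; j \<in> I; i \<noteq> j; w \<in> carrier_vec M\<rbrakk> \<Longrightarrow> \<exists>!v. v \<in> V i \<and> w + v \<in> V j"
begin

definition points :: "'a vec set" where
  "points = (\<Union>i \<in> I. V i) - {0\<^sub>v M}"

lemma V_carrier': "i \<in> I \<Longrightarrow> v \<in> V i \<Longrightarrow> v \<in> carrier_vec M"
  using V_carrier by blast

lemma finite_V: "i \<in> I \<Longrightarrow> finite (V i)"
  using V_carrier finite_carrier_vec by (rule finite_subset)

text \<open>Both \<open>v\<close> and zero satisfy the condition of \<open>complement\<close> at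
  \<open>w = 0\<close>.\<close>

lemma V_inter:
  assumes "i \<in> I" "j \<in> I" "i \<noteq> j" "v \<in> V i" "v \<in> V j"
  shows "v = 0\<^sub>v M"
proof -
  have "\<exists>!v. v \<in> V i \<and> 0\<^sub>v M + v \<in> V j" using assms by (intro complement) auto
  moreover have "0\<^sub>v M + v \<in> V j" "0\<^sub>v M + 0\<^sub>v M \<in> V j"
    using assms V_carrier'[of i v] V_zero by auto
  ultimately show ?thesis using assms V_zero by blast
qed

lemma V_add_cancel:
  assumes "i \<in> I" "w \<in> carrier_vec M" "v \<in> V i" "w + v \<in> V i"
  shows "w \<in> V i"
proof -
  have "w = (w + v) + - v" using assms V_carrier'[of i v] by (intro eq_vecI) auto
  also have "\<dots> \<in> V i" using assms V_add V_uminus by blast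
  finally show ?thesis .
qed

text \<open>The pair \<open>(i, j)\<close> corresponds to the unique \<open>v \<in> V i\<close> with \<open>w + v \<in> V j\<close>.\<close>

lemma card_transversals:
  assumes K: "K \<subseteq> I" and w: "w \<in> carrier_vec M" and notin: "\<And>i. i \<in> K \<Longrightarrow> w \<notin> V i"
  shows "card {v. \<exists>i \<in> K. \<exists>j \<in> K. i \<noteq> j \<and> v \<in> V i \<and> w + v \<in> V j} = card K * (card K - 1)"
proof -
  define f where "f = (\<lambda>(i, j). THE v. v \<in> V i \<and> w + v \<in> V j)"
  let ?K = "SIGMA i:K. K - {i}"
  have f: "f (i, j) \<in> V i \<and> w + f (i, j) \<in> V j" if "i \<in> K" "j \<in> K" "i \<noteq> j" for i j
    unfolding f_def using that K theI'[OF complement[of i j w]] w by auto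
  have f_eq: "f (i, j) = v" if "i \<in> K" "j \<in> K" "i \<noteq> j" "v \<in> V i" "w + v \<in> V j" for i j v
    using f[OF that(1-3)] complement[of i j w] that K w by blast
  have "inj_on f ?K"
  proof (rule inj_onI)
    fix p p' assume p: "p \<in> ?K" "p' \<in> ?K" "f p = f p'"
    obtain i j i' j' where ij: "p = (i, j)" "p' = (i', j')" by fastforce
    let ?v = "f p"
    have mem: "i \<in> K" "j \<in> K" "i \<noteq> j" "i' \<in> K" "j' \<in> K" "i' \<noteq> j'" using p ij by auto
    then have I: "i \<in> I" "j \<in> I" "i' \<in> I" "j' \<in> I" using K by auto
    have v: "?v \<in> V i" "?v \<in> V i'" "w + ?v \<in> V j" "w + ?v \<in> V j'"
      using f[OF mem(1-3)] f[OF mem(4-6)] p ij by auto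
    have vc: "?v \<in> carrier_vec M" using V_carrier' I v by blast
    \<comment> \<open>As \<open>w\<close> lies in no \<open>V i\<close> with
      \<open>i \<in> K\<close>, neither \<open>?v\<close> nor \<open>w + ?v\<close> is zero, so each
      lies in only one of the groups and the pair can be recovered from \<open>?v\<close>.\<close>
    have "?v \<noteq> 0\<^sub>v M" using v(3) notin[OF mem(2)] w by auto
    then have "i = i'" using V_inter[OF I(1,3)] v by blast
    moreover have "w + ?v \<noteq> 0\<^sub>v M"
      using V_add_cancel[OF I(1) w v(1)] notin[OF mem(1)] V_zero[OF I(1)] by auto
    then have "j = j'" using V_inter[OF I(2,4)] v by blast
    ultimately show "p = p'" using ij by simp
  qed
  moreover have "f ` ?K = {v. \<exists>i \<in> K. \<exists>j \<in> K. i \<noteq> j \<and> v \<in> V i \<and> w + v \<in> V j}"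
  proof (intro equalityI subsetI)
    fix v assume "v \<in> f ` ?K"
    then obtain i j where ij: "i \<in> K" "j \<in> K" "i \<noteq> j" and v: "v = f (i, j)" by auto
    show "v \<in> {v. \<exists>i \<in> K. \<exists>j \<in> K. i \<noteq> j \<and> v \<in> V i \<and> w + v \<in> V j}"
      using f[OF ij] ij unfolding v by blast
  next
    fix v assume "v \<in> {v. \<exists>i \<in> K. \<exists>j \<in> K. i \<noteq> j \<and> v \<in> V i \<and> w + v \<in> V j}"
    then obtain i j where ij: "i \<in> K" "j \<in> K" "i \<noteq> j" "v \<in> V i" "w + v \<in> V j" by auto
    then have "(i, j) \<in> ?K" by auto
    then show "v \<in> f ` ?K" using f_eq[OF ij] by (metis image_eqI)
  qed
  ultimately have "card {v. \<exists>i \<in> K. \<exists>j \<in> K. i \<noteq> j \<and> v \<in> V i \<and> w + v \<in> V j} = card ?K"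
    by (metis card_image)
  also have "\<dots> = (\<Sum>i \<in> K. card (K - {i}))"
    using finite_subset[OF K finite_I] by (intro card_SigmaI) auto
  also have "\<dots> = card K * (card K - 1)" by simp
  finally show ?thesis .
qed

text \<open>A move within a single \<open>V i\<close> would put \<open>w\<close> into
  \<open>V i\<close>, so only pairs \<open>i \<noteq> j\<close> remain, and for these neither
  \<open>v\<close> nor \<open>w + v\<close> vanishes.\<close>

lemma count_off_points:
  assumes w: "w \<in> carrier_vec M" "w \<noteq> 0\<^sub>v M" "w \<notin> points"
  shows "card {v \<in> points. w + v \<in> points} = card I * (card I - 1)"
proof -
  have notin: "w \<notin> V i" if "i \<in> I" for i using w that by (auto simp: points_def)
  have "{v \<in> points. w + v \<in> points} = {v. \<exists>i \<in> I. \<exists>j \<in> I. i \<noteq> j \<and> v \<in> V i \<and> w + v \<in> V j}"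
  proof (intro equalityI subsetI)
    fix v assume "v \<in> {v \<in> points. w + v \<in> points}"
    then obtain i j where ij: "i \<in> I" "j \<in> I" "v \<in> V i" "w + v \<in> V j" by (auto simp: points_def)
    then have "i \<noteq> j" using V_add_cancel[OF _ w(1)] notin by blast
    then show "v \<in> {v. \<exists>i \<in> I. \<exists>j \<in> I. i \<noteq> j \<and> v \<in> V i \<and> w + v \<in> V j}" using ij by blast
  next
    fix v assume "v \<in> {v. \<exists>i \<in> I. \<exists>j \<in> I. i \<noteq> j \<and> v \<in> V i \<and> w + v \<in> V j}"
    then obtain i j where ij: "i \<in> I" "j \<in> I" "v \<in> V i" "w + v \<in> V j" by blast
    have "v \<noteq> 0\<^sub>v M" using ij notin w(1) by auto
    moreover have "w + v \<noteq> 0\<^sub>v M"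
      using V_add_cancel[OF ij(1) w(1) ij(3)] V_zero[OF ij(1)] notin ij by auto
    ultimately show "v \<in> {v \<in> points. w + v \<in> points}" using ij by (auto simp: points_def)
  qed
  then show ?thesis using card_transversals[of I, OF _ w(1) notin] by simp
qed

text \<open>For \<open>w\<close> in \<open>V l\<close>, a move \<open>v\<close> in
  \<open>V l\<close> stays there, and only \<open>0\<close> and \<open>- w\<close> are excluded. If
  \<open>v\<close> is outside \<open>V l\<close>, so is \<open>w + v\<close>; as \<open>w\<close>
  lies in no other \<open>V i\<close>, \<open>card_transversals\<close> applies to the indices other
  than \<open>l\<close>.\<close>

lemma count_on_points:
  assumes w: "w \<in> points"
  shows "card {v \<in> points. w + v \<in> points} = m - 2 + (card I - 1) * (card I - 2)"
proof -
  obtain l where l: "l \<in> I" "w \<in> V l" and w0: "w \<noteq> 0\<^sub>v M" using w by (auto simp: points_def)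
  have wc: "w \<in> carrier_vec M" using V_carrier' l by blast
  let ?T = "{v. \<exists>i \<in> I - {l}. \<exists>j \<in> I - {l}. i \<noteq> j \<and> v \<in> V i \<and> w + v \<in> V j}"
  have notin: "w \<notin> V i" if "i \<in> I - {l}" for i using V_inter[of i l w] that l w0 by auto
  have neg: "v = - w" if "v \<in> carrier_vec M" "w + v = 0\<^sub>v M" for v
    using add_vec_eq_zero_iff[OF wc that(1)] that(2) by simp
  have T: "v \<noteq> 0\<^sub>v M \<and> w + v \<noteq> 0\<^sub>v M \<and> v \<notin> V l" if v: "v \<in> ?T" for v
  proof -
    obtain i j where ij: "i \<in> I" "j \<in> I" "i \<noteq> l" "j \<noteq> l" "v \<in> V i" "w + v \<in> V j" using v by blast
    have "v \<noteq> 0\<^sub>v M" using ij notin wc by auto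
    moreover have "w + v \<noteq> 0\<^sub>v M"
      using V_add_cancel[OF ij(1) wc ij(5)] V_zero[OF ij(1)] notin ij by auto
    ultimately show ?thesis using V_inter[OF ij(1) l(1) ij(3,5)] by blast
  qed
  have "{v \<in> points. w + v \<in> points} = (V l - {0\<^sub>v M, - w}) \<union> ?T"
  proof (intro equalityI subsetI)
    fix v assume v: "v \<in> {v \<in> points. w + v \<in> points}"
    then obtain i j where ij: "i \<in> I" "j \<in> I" "v \<in> V i" "w + v \<in> V j"
      and v0: "v \<noteq> 0\<^sub>v M" "w + v \<noteq> 0\<^sub>v M" by (auto simp: points_def)
    have vc: "v \<in> carrier_vec M" using V_carrier' ij by blast
    have "v \<noteq> - w" using v0(2) wc by auto
    show "v \<in> (V l - {0\<^sub>v M, - w}) \<union> ?T"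
    proof (cases "v \<in> V l")
      case False
      then have "i \<noteq> l" using ij by auto
      moreover have "i \<noteq> j"
        using V_add_cancel[OF ij(1) wc ij(3)] ij notin \<open>i \<noteq> l\<close> by blast
      moreover have "j \<noteq> l"
      proof
        assume "j = l"
        then have "v + w \<in> V l" using ij comm_add_vec[OF vc wc] by simp
        then show False using V_add_cancel[OF l(1) vc l(2)] False by simp
      qed
      ultimately show ?thesis using ij by blast
    qed (use v0 \<open>v \<noteq> - w\<close> in auto)
  next
    fix v assume "v \<in> (V l - {0\<^sub>v M, - w}) \<union> ?T"
    then consider "v \<in> V l" "v \<noteq> 0\<^sub>v M" "v \<noteq> - w" | "v \<in> ?T" by blast
    then show "v \<in> {v \<in> points. w + v \<in> points}"
    proof cases
      case 1
      then have "w + v \<in> V l" "w + v \<noteq> 0\<^sub>v M" using V_add l neg V_carrier' by blast+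
      then show ?thesis using 1 l by (auto simp: points_def)
    next
      case 2
      then show ?thesis using T[OF 2] by (auto simp: points_def)
    qed
  qed
  moreover have "finite ?T"
    by (rule finite_subset[of _ "\<Union>i \<in> I. V i"]) (use finite_I finite_V in auto)
  moreover have "(V l - {0\<^sub>v M, - w}) \<inter> ?T = {}" using T by blast
  ultimately have "card {v \<in> points. w + v \<in> points} = card (V l - {0\<^sub>v M, - w}) + card ?T"
    using finite_V[OF l(1)] by (simp add: card_Un_disjoint)
  also have "card ?T = (card I - 1) * (card I - 2)"
    using card_transversals[of "I - {l}", OF _ wc notin] l finite_I by (simp add: numeral_2_eq_2)
  also have "card (V l - {0\<^sub>v M, - w}) = m - 2"
  proof -
    have "- w \<noteq> 0\<^sub>v M"
      using w0 by (metis uminus_uminus_vec uminus_zero_vec)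
    then have "card {0\<^sub>v M, - w} = 2" by simp
    then show ?thesis
      using V_zero V_uminus l finite_V card_V by (subst card_Diff_subset) auto
  qed
  finally show ?thesis .
qed

lemma points_sum:
  assumes "card I \<ge> 2" and w: "w \<in> carrier_vec M" "w \<noteq> 0\<^sub>v M" "w \<notin> points"
  shows "\<exists>v \<in> points. w + v \<in> points"
proof -
  have "card {v \<in> points. w + v \<in> points} > 0" using assms by (simp add: count_off_points)
  then show ?thesis by (metis (no_types, lifting) Collect_empty_eq card.empty less_irrefl)
qed

text \<open>The sums from two different \<open>V i\<close> and \<open>V j\<close> give
  \<open>m * m\<close> distinct vectors, since the difference of two representations lies in the
  intersection. The union of all \<open>V i\<close> has at most \<open>1 + (m - 1) * (m - 1)\<close>
  elements, which is fewer.\<close>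

lemma points_not_all:
  assumes I: "card I \<ge> 2" and m: "card I < m"
  shows "\<exists>w \<in> carrier_vec M. w \<noteq> 0\<^sub>v M \<and> w \<notin> points"
proof (rule ccontr)
  assume "\<not> ?thesis"
  then have "carrier_vec M \<subseteq> insert (0\<^sub>v M) (\<Union>i \<in> I. V i - {0\<^sub>v M})" by (auto simp: points_def)
  moreover have fin: "finite (\<Union>i \<in> I. V i - {0\<^sub>v M})" using finite_I finite_V by auto
  ultimately have "card (carrier_vec M :: 'a vec set)
      \<le> card (insert (0\<^sub>v M) (\<Union>i \<in> I. V i - {0\<^sub>v M}))"
    by (intro card_mono) auto
  also have "\<dots> \<le> Suc (card (\<Union>i \<in> I. V i - {0\<^sub>v M}))"
    using fin by (metis card_insert_if le_SucI order_refl)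
  also have "card (\<Union>i \<in> I. V i - {0\<^sub>v M}) \<le> (\<Sum>i \<in> I. card (V i - {0\<^sub>v M}))"
    by (rule card_UN_le[OF finite_I])
  also have "\<dots> = card I * (m - 1)" using V_zero card_V by simp
  also have "\<dots> \<le> (m - 1) * (m - 1)" using m by (intro mult_right_mono) auto
  finally have upper: "card (carrier_vec M :: 'a vec set) \<le> Suc ((m - 1) * (m - 1))" by simp
  obtain i j where ij: "i \<in> I" "j \<in> I" "i \<noteq> j"
    using I by (metis card_le_Suc0_iff_eq finite_I not_less_eq_eq numeral_2_eq_2)
  have "inj_on (\<lambda>(u, v). u + v) (V i \<times> V j)"
  proof (rule inj_onI, clarify)
    fix u v u' v' assume u: "u \<in> V i" "u' \<in> V i" and v: "v \<in> V j" "v' \<in> V j"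
      and eq: "u + v = u' + v'"
    have c: "u \<in> carrier_vec M" "u' \<in> carrier_vec M" "v \<in> carrier_vec M" "v' \<in> carrier_vec M"
      using u v ij V_carrier' by blast+
    have e: "u $ l + v $ l = u' $ l + v' $ l" if "l < M" for l
      using arg_cong[OF eq, of "\<lambda>x. x $ l"] c that by simp
    have "u + - u' = v' + - v" using c e by (intro eq_vecI) (auto simp: algebra_simps)
    moreover have "u + - u' \<in> V i" "v' + - v \<in> V j" using u v ij V_add V_uminus by blast+
    ultimately have "u + - u' = 0\<^sub>v M" "v' + - v = 0\<^sub>v M" using V_inter[OF ij] by metis+
    then have "(u + - u') $ l = 0" "(v' + - v) $ l = 0" if "l < M" for l using that by simp_all
    then show "u = u' \<and> v = v'" using c by (auto intro!: eq_vecI)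
  qed
  then have "m * m = card ((\<lambda>(u, v). u + v) ` (V i \<times> V j))"
    using card_V ij by (simp add: card_image card_cartesian_product)
  also have "\<dots> \<le> card (carrier_vec M :: 'a vec set)"
    using V_carrier' ij by (intro card_mono finite_carrier_vec) auto
  finally have "m * m \<le> Suc ((m - 1) * (m - 1))" using upper by simp
  moreover obtain t where "m = Suc (Suc t)"
    using I m by (metis less_imp_Suc_add add_Suc_right le_less_trans numeral_2_eq_2 add_Suc)
  ultimately show False by simp
qed

end

section \<open>Cyclic Hamming codes\<close>

lemma vec_span_singleton:
  fixes v :: "'a :: field vec"
  assumes v: "v \<in> carrier_vec k"
  shows "vec_span k {v} = range (\<lambda>a. a \<cdot>\<^sub>v v)"
proof -
  interpret vec_space "TYPE('a)" k .
  have "lincomb a {v} = a v \<cdot>\<^sub>v v" for a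
    unfolding lincomb_def using v by (subst finsum_insert) auto
  then have "span {v} = range (\<lambda>a. a v \<cdot>\<^sub>v v)"
    using finite_span[of "{v}"] v by auto
  also have "\<dots> = range (\<lambda>a. a \<cdot>\<^sub>v v)"
  proof (intro equalityI subsetI)
    fix w assume "w \<in> range (\<lambda>a. a \<cdot>\<^sub>v v)"
    then obtain a where "w = a \<cdot>\<^sub>v v" by auto
    then show "w \<in> range (\<lambda>a. a v \<cdot>\<^sub>v v)" by (intro range_eqI[of _ _ "\<lambda>_. a"])
  qed auto
  finally show ?thesis .
qed

lemma subspace_vec_span:
  fixes S :: "'a :: field vec set"
  assumes "S \<subseteq> carrier_vec k"
  shows "subvectorspace k (vec_span k S)"
proof -
  interpret vec_space "TYPE('a)" k .
  show ?thesis using span_is_subspace assms by simp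
qed

lemma subspace_dim_span_singleton:
  fixes v :: "'a :: field vec"
  assumes v: "v \<in> carrier_vec k"
  shows "subspace_dim k (vec_span k {v}) = (if v = 0\<^sub>v k then 0 else 1)"
proof -
  interpret vec_space "TYPE('a)" k .
  let ?W = "span {v}"
  have sub: "submodule class_ring ?W V" using v by (intro span_is_submodule) auto
  interpret W: vectorspace class_ring "V\<lparr>carrier := ?W\<rparr>"
    using subspace_is_vs[OF span_is_subspace] v by simp
  have mem: "v \<in> ?W" using v span_self by simp
  have gen: "LinearCombinations.module.span class_ring (V\<lparr>carrier := ?W\<rparr>) {v} = ?W"
    using span_li_not_depend(1)[OF _ sub, of "{v}"] mem by simp
  show ?thesis
  proof (cases "v = 0\<^sub>v k")
    case True
    then show ?thesis using gen W.dim0I by (simp add: module_vec_simps)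
  next
    case False
    then show ?thesis using gen mem W.dim1I[of v] by (simp add: module_vec_simps)
  qed
qed

text \<open>Columns with a common nonzero multiple span the same line, which gives
  \<open>i = j\<close> by injectivity of the bijection; comparing a nonzero entry then gives
  \<open>a = b\<close>.\<close>

lemma hamming_projective_system:
  fixes H :: "'a :: {field, finite} mat"
  assumes H: "hamming_check_matrix k n H"
  shows "projective_system H k n"
proof -
  have c: "H \<in> carrier_mat k n"
    and bij: "bij_betw (\<lambda>j. vec_span k {col H j}) {..<n} {L. subvectorspace k L \<and> subspace_dim k L = 1}"
    using H by (auto simp: hamming_check_matrix_def)
  have col: "col H j \<in> carrier_vec k" if "j < n" for j using c that by auto
  have nz: "col H j \<noteq> 0\<^sub>v k" if "j < n" for j
  proof -
    have "subspace_dim k (vec_span k {col H j}) = 1"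
      using bij_betwE[OF bij] that by auto
    then show ?thesis using subspace_dim_span_singleton[OF col[OF that]] by auto
  qed
  show ?thesis
  proof
    fix a b :: 'a and i j
    assume ab: "a \<noteq> 0" "b \<noteq> 0" and ij: "i < n" "j < n" and eq: "a \<cdot>\<^sub>v col H i = b \<cdot>\<^sub>v col H j"
    have "range (\<lambda>t. t \<cdot>\<^sub>v (c \<cdot>\<^sub>v v)) = range (\<lambda>t. t \<cdot>\<^sub>v v)" if "c \<noteq> 0" for c :: 'a and v
    proof (intro equalityI subsetI)
      fix w assume "w \<in> range (\<lambda>t. t \<cdot>\<^sub>v v)"
      then obtain t where "w = t \<cdot>\<^sub>v v" by auto
      then have "w = (t * inverse c) \<cdot>\<^sub>v (c \<cdot>\<^sub>v v)"
        using that by (simp add: smult_smult_assoc mult.assoc)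
      then show "w \<in> range (\<lambda>t. t \<cdot>\<^sub>v (c \<cdot>\<^sub>v v))" by blast
    qed (auto simp: smult_smult_assoc)
    then have "vec_span k {col H i} = vec_span k {col H j}"
      using ab ij eq by (metis vec_span_singleton[OF col])
    then have "i = j" using bij ij unfolding bij_betw_def inj_on_def by blast
    obtain r where r: "r < k" "col H i $ r \<noteq> 0"
      using nz[OF ij(1)] col[OF ij(1)] by (metis carrier_vecD eq_vecI index_zero_vec)
    have "(a \<cdot>\<^sub>v col H i) $ r = (b \<cdot>\<^sub>v col H i) $ r" using eq \<open>i = j\<close> by simp
    then have "a * col H i $ r = b * col H i $ r" using r(1) c ij(1) by simp
    then show "a = b \<and> i = j" using r(2) \<open>i = j\<close> by simp
  qed (use c nz in auto)
qed

text \<open>A nonzero vector spans a line, and by surjectivity of the bijection that line is also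
  spanned by some column.\<close>

lemma hamming_multiples:
  fixes H :: "'a :: {field, finite} mat"
  assumes H: "hamming_check_matrix k n H"
  shows "projective_system.multiples H n = carrier_vec k - {0\<^sub>v k}"
proof -
  interpret projective_system H k n by (rule hamming_projective_system[OF H])
  have bij: "bij_betw (\<lambda>j. vec_span k {col H j}) {..<n} {L. subvectorspace k L \<and> subspace_dim k L = 1}"
    using H by (auto simp: hamming_check_matrix_def)
  have "v \<in> multiples" if v: "v \<in> carrier_vec k" "v \<noteq> 0\<^sub>v k" for v
  proof -
    have "vec_span k {v} \<in> {L. subvectorspace k L \<and> subspace_dim k L = 1}"
      using v subspace_vec_span[of "{v}" k] subspace_dim_span_singleton[OF v(1)] by simp
    then obtain j where j: "j < n" "vec_span k {v} = vec_span k {col H j}"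
      using bij unfolding bij_betw_def by (metis (no_types, lifting) imageE lessThan_iff)
    then have "v \<in> range (\<lambda>a. a \<cdot>\<^sub>v col H j)"
      using vec_span_singleton[OF v(1)] vec_span_singleton[OF col_carrier[OF j(1)]]
      by (metis one_smult_vec rangeI)
    then obtain a where a: "v = a \<cdot>\<^sub>v col H j" by auto
    have "0 \<cdot>\<^sub>v col H j = 0\<^sub>v k" using P_carrier j(1) by (intro eq_vecI) auto
    then have "a \<noteq> 0" using v a by auto
    then show ?thesis using a j unfolding multiples_iff by blast
  qed
  then show ?thesis using multiples_carrier zero_notin_multiples by blast
qed

text \<open>\<open>multiples_all\<close> is the Hamming property in the form used below;
  \<open>n_ge_2\<close> will come from \<open>c \<in> {2..n}\<close>.\<close>

locale cyclic_hamming = projective_system H k n for H :: "'a :: {field, finite} mat" and k n +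
  assumes multiples_all: "multiples = carrier_vec k - {0\<^sub>v k}"
    and cyclic: "cyclic_code code"
    and n_ge_2: "n \<ge> 2"
begin

lemma nonzero_cases:
  assumes "v \<in> carrier_vec k" "v \<noteq> 0\<^sub>v k"
  obtains a j where "a \<noteq> 0" "j < n" "v = a \<cdot>\<^sub>v col H j"
proof -
  have "v \<in> multiples" using assms multiples_all by blast
  then show thesis using that unfolding multiples_iff by blast
qed

text \<open>This number is \<open>q ^ k\<close>, written through \<open>n\<close> by counting the
  multiples of the columns.\<close>

lemma card_carrier: "card (carrier_vec k :: 'a vec set) = Suc ((card (UNIV :: 'a set) - 1) * n)"
proof -
  have "carrier_vec k = insert (0\<^sub>v k) multiples"
    unfolding multiples_all by (simp add: insert_absorb)
  then have "card (carrier_vec k :: 'a vec set) = Suc (card multiples)"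
    using finite_multiples zero_notin_multiples by simp
  then show ?thesis by (simp add: card_multiples)
qed

section \<open>The shift operator of a cyclic Hamming code\<close>

lemma right_inverse: obtains X where "X \<in> carrier_mat n k" "H * X = 1\<^sub>m k"
proof -
  have "\<exists>x \<in> carrier_vec n. H *\<^sub>v x = unit_vec k r" if r: "r < k" for r
  proof -
    have "unit_vec k r \<noteq> (0\<^sub>v k :: 'a vec)" using r by (metis index_unit_vec(1) index_zero_vec(1) one_neq_zero)
    then obtain a j where "j < n" "unit_vec k r = a \<cdot>\<^sub>v col H j"
      using nonzero_cases unit_vec_carrier by metis
    then have "H *\<^sub>v (a \<cdot>\<^sub>v unit_vec n j) = unit_vec k r"
      using P_carrier by (simp add: mult_mat_vec[of _ k n] mult_unit_vec)
    then show ?thesis by (intro bexI[of _ "a \<cdot>\<^sub>v unit_vec n j"]) auto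
  qed
  then obtain x where x: "\<And>r. r < k \<Longrightarrow> x r \<in> carrier_vec n" "\<And>r. r < k \<Longrightarrow> H *\<^sub>v x r = unit_vec k r"
    by metis
  define X where "X = mat n k (\<lambda>(i, r). x r $ i)"
  have X: "X \<in> carrier_mat n k" by (simp add: X_def)
  have colX: "col X r = x r" if "r < k" for r
    using that x(1)[OF that] by (intro eq_vecI) (auto simp: X_def)
  have "H * X = 1\<^sub>m k"
  proof (rule mat_col_eqI)
    fix r assume "r < dim_col (1\<^sub>m k :: 'a mat)"
    then have r: "r < k" by simp
    have "col (H * X) r = H *\<^sub>v col X r" using P_carrier X r by (intro col_mult2) auto
    then show "col (H * X) r = col (1\<^sub>m k) r" using colX r x(2) by simp
  qed (use P_carrier X in auto)
  then show thesis using that X by blast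
qed

text \<open>Since the code is cyclic, the matrix \<open>H'\<close> obtained by shifting the columns of \<open>H\<close> to the left
  annihilates the kernel of \<open>H\<close>, hence \<open>H' = T H\<close> for some \<open>T\<close>.\<close>

lemma shift_matrix:
  obtains T where "T \<in> carrier_mat k k" "\<And>j. j < n \<Longrightarrow> T *\<^sub>v col H j = col H ((j + 1) mod n)"
proof -
  obtain X where X: "X \<in> carrier_mat n k" "H * X = 1\<^sub>m k" by (rule right_inverse)
  define H' where "H' = mat k n (\<lambda>(i, j). H $$ (i, (j + 1) mod n))"
  have H': "H' \<in> carrier_mat k n" by (simp add: H'_def)
  have ker: "H' *\<^sub>v x = 0\<^sub>v k" if x: "x \<in> carrier_vec n" "H *\<^sub>v x = 0\<^sub>v k" for x
  proof -
    let ?y = "cyclic_shift x"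
    have "x \<in> code" using x by (simp add: code_iff)
    then have "?y \<in> code" using cyclic by (simp add: cyclic_code_def)
    then have y: "?y \<in> carrier_vec n" "H *\<^sub>v ?y = 0\<^sub>v k" by (auto simp: code_iff)
    \<comment> \<open>Shifting the columns to the left has the same effect as shifting the
      coordinates of \<open>x\<close> to the right.\<close>
    have "H' *\<^sub>v x = H *\<^sub>v ?y"
    proof (rule eq_vecI)
      fix i assume "i < dim_vec (H *\<^sub>v ?y)"
      then have i: "i < k" using P_carrier by simp
      have "(H' *\<^sub>v x) $ i = (\<Sum>j < n. H $$ (i, (j + 1) mod n) * x $ j)"
        using i x(1) H' by (simp add: scalar_prod_def H'_def atLeast0LessThan)
      also have "\<dots> = (\<Sum>j < n. H $$ (i, j) * x $ ((j + n - 1) mod n))"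
      proof (rule sum.reindex_bij_witness[of _ "\<lambda>j. (j + n - 1) mod n" "\<lambda>j. (j + 1) mod n"])
        fix j assume j: "j \<in> {..<n}"
        then show "((j + 1) mod n + n - 1) mod n = j" "((j + n - 1) mod n + 1) mod n = j"
          using n_ge_2 by (auto simp: mod_if split: if_splits)
        then show "H $$ (i, (j + 1) mod n) * x $ (((j + 1) mod n + n - 1) mod n)
          = H $$ (i, (j + 1) mod n) * x $ j" by simp
      qed (use n_ge_2 in auto)
      also have "\<dots> = (H *\<^sub>v ?y) $ i"
        using i x(1) P_carrier by (simp add: scalar_prod_def cyclic_shift_def atLeast0LessThan)
      finally show "(H' *\<^sub>v x) $ i = (H *\<^sub>v ?y) $ i" .
    qed (use H' P_carrier in auto)
    then show ?thesis using y by simp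
  qed
  have eq: "H' *\<^sub>v x = H' *\<^sub>v y"
    if x: "x \<in> carrier_vec n" and y: "y \<in> carrier_vec n" and "H *\<^sub>v x = H *\<^sub>v y" for x y
  proof -
    have "H *\<^sub>v (x - y) = H *\<^sub>v x - H *\<^sub>v y"
      using x y P_carrier by (intro mult_minus_distrib_mat_vec) auto
    also have "\<dots> = 0\<^sub>v k" using that P_carrier by auto
    finally have "H' *\<^sub>v (x - y) = 0\<^sub>v k" using x y by (intro ker) auto
    moreover have "H' *\<^sub>v (x - y) = H' *\<^sub>v x - H' *\<^sub>v y"
      using x y H' by (intro mult_minus_distrib_mat_vec) auto
    ultimately have "(H' *\<^sub>v x - H' *\<^sub>v y) $ i = 0" if "i < k" for i using that by simp
    then show ?thesis using H' by (intro eq_vecI) auto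
  qed
  \<comment> \<open>The required \<open>T\<close> is \<open>H' X\<close>: the vector
    \<open>X h_j\<close> has the same syndrome as the unit vector \<open>e_j\<close>, hence the same
    image under \<open>H'\<close>, and that of \<open>e_j\<close> is the next column.\<close>
  have "H' * X *\<^sub>v col H j = col H ((j + 1) mod n)" if j: "j < n" for j
  proof -
    have "H * X *\<^sub>v col H j = H *\<^sub>v (X *\<^sub>v col H j)"
      using P_carrier X col_carrier[OF j] by (intro assoc_mult_mat_vec)
    then have "H *\<^sub>v (X *\<^sub>v col H j) = H *\<^sub>v unit_vec n j"
      using X(2) col_carrier[OF j] mult_unit_vec[OF j] by simp
    then have "H' *\<^sub>v (X *\<^sub>v col H j) = H' *\<^sub>v unit_vec n j"
      using X col_carrier[OF j] by (intro eq) auto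
    also have "\<dots> = col H ((j + 1) mod n)"
      using H' P_carrier j n_ge_2 by (intro eq_vecI) (auto simp: H'_def)
    finally show ?thesis
      using assoc_mult_mat_vec[OF H' X(1) col_carrier[OF j]] by simp
  qed
  moreover have "H' * X \<in> carrier_mat k k" using H' X by auto
  ultimately show thesis using that by blast
qed

definition shift :: "'a mat" where
  "shift = (SOME T. T \<in> carrier_mat k k \<and> (\<forall>j < n. T *\<^sub>v col H j = col H ((j + 1) mod n)))"

lemma shift_carrier: "shift \<in> carrier_mat k k"
  and shift_col: "j < n \<Longrightarrow> shift *\<^sub>v col H j = col H ((j + 1) mod n)"
proof -
  have "\<exists>T. T \<in> carrier_mat k k \<and> (\<forall>j < n. T *\<^sub>v col H j = col H ((j + 1) mod n))"
    using shift_matrix by metis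
  from someI_ex[OF this] show "shift \<in> carrier_mat k k"
    and "j < n \<Longrightarrow> shift *\<^sub>v col H j = col H ((j + 1) mod n)" unfolding shift_def by auto
qed

abbreviation power :: "nat \<Rightarrow> 'a mat" where
  "power e \<equiv> shift ^\<^sub>m e"

lemma power_carrier: "power e \<in> carrier_mat k k"
  using shift_carrier by (rule pow_carrier_mat)

lemma power_col: "j < n \<Longrightarrow> power e *\<^sub>v col H j = col H ((j + e) mod n)"
proof (induction e arbitrary: j)
  case 0
  then show ?case using shift_carrier col_carrier[of j] by simp
next
  case (Suc e)
  have "power (Suc e) *\<^sub>v col H j = power e *\<^sub>v (shift *\<^sub>v col H j)"
    using assoc_mult_mat_vec[OF power_carrier shift_carrier col_carrier[OF Suc.prems]] by simp
  also have "\<dots> = col H (((j + 1) mod n + e) mod n)"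
    using Suc n_ge_2 by (simp add: shift_col)
  also have "((j + 1) mod n + e) mod n = (j + Suc e) mod n" by (simp add: mod_add_left_eq)
  finally show ?case .
qed

text \<open>Since \<open>v\<close> is a multiple of some column \<open>j\<close>, both sides are
  nonzero multiples of columns, with indices \<open>j + e\<close> and \<open>j + f\<close> modulo
  \<open>n\<close>, so these indices agree.\<close>

lemma power_eigen:
  assumes "v \<in> carrier_vec k" "v \<noteq> 0\<^sub>v k" "power e *\<^sub>v v = a \<cdot>\<^sub>v (power f *\<^sub>v v)" "a \<noteq> 0"
  shows "e mod n = f mod n"
proof -
  obtain b j where b: "b \<noteq> 0" "j < n" "v = b \<cdot>\<^sub>v col H j" using assms nonzero_cases by metis
  have *: "power e *\<^sub>v v = b \<cdot>\<^sub>v col H ((j + e) mod n)" for e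
    using b mult_mat_vec[OF power_carrier col_carrier[OF b(2)]] power_col[OF b(2)] by simp
  have "b \<cdot>\<^sub>v col H ((j + e) mod n) = (a * b) \<cdot>\<^sub>v col H ((j + f) mod n)"
    using assms(3) unfolding * by (simp add: smult_smult_assoc)
  then have "(j + e) mod n = (j + f) mod n"
    using col_inj[of b "a * b"] b assms(4) n_ge_2 by auto
  then have "(n - j + (j + e)) mod n = (n - j + (j + f)) mod n"
    by (rule mod_add_cong[OF refl])
  moreover have "n - j + (j + e) = n + e" for e using b(2) by simp
  ultimately show ?thesis by simp
qed

end

section \<open>Power sums over a finite field\<close>

lemma of_nat_card_field: "of_nat (card (UNIV :: 'a :: {field, finite} set)) = (0 :: 'a)"
proof -
  \<comment> \<open>Translation by 1 permutes the field, so the sum of \<open>q\<close> ones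
    vanishes.\<close>
  have "(\<Sum>x \<in> (UNIV :: 'a set). x + 1) = (\<Sum>x \<in> (UNIV :: 'a set). x)"
    by (rule sum.reindex_bij_witness[of _ "\<lambda>x. x - 1" "\<lambda>x. x + 1"]) auto
  then show ?thesis by (simp add: sum.distrib)
qed

text \<open>The polynomial \<open>X^i - 1\<close> has at most \<open>i < q - 1\<close> roots, so
  some nonzero \<open>b\<close> has \<open>b^i \<noteq> 1\<close>. Multiplication by
  \<open>b\<close> permutes the nonzero elements, so the sum equals \<open>b^i\<close> times
  itself.\<close>

lemma sum_powers_field:
  assumes "0 < i" "i < card (UNIV :: 'a :: {field, finite} set) - 1"
  shows "(\<Sum>a \<in> (UNIV :: 'a set) - {0}. inverse a ^ i) = 0"
proof -
  have "\<exists>b :: 'a. b \<noteq> 0 \<and> b ^ i \<noteq> 1"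
  proof (rule ccontr)
    assume "\<not> (\<exists>b :: 'a. b \<noteq> 0 \<and> b ^ i \<noteq> 1)"
    then have "UNIV - {0} \<subseteq> {x :: 'a. poly (monom 1 i - 1) x = 0}" by (auto simp: poly_monom)
    moreover have nz: "monom (1 :: 'a) i - 1 \<noteq> 0"
      using assms(1) by (metis degree_1 degree_monom_eq eq_iff_diff_eq_0 less_irrefl one_neq_zero)
    ultimately have "card (UNIV - {0 :: 'a}) \<le> card {x :: 'a. poly (monom 1 i - 1) x = 0}"
      by (intro card_mono) auto
    also have "\<dots> \<le> degree (monom (1 :: 'a) i - 1)" by (rule card_poly_roots_bound[OF nz])
    also have "\<dots> \<le> i" by (rule degree_diff_le) (auto simp: degree_monom_le)
    finally show False using assms(2) by (simp add: card_Diff_subset)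
  qed
  then obtain b :: 'a where b: "b \<noteq> 0" "b ^ i \<noteq> 1" by blast
  let ?s = "\<Sum>a \<in> (UNIV :: 'a set) - {0}. inverse a ^ i"
  have "b ^ i * ?s = (\<Sum>a \<in> (UNIV :: 'a set) - {0}. (b * inverse a) ^ i)"
    by (simp add: sum_distrib_left power_mult_distrib)
  also have "\<dots> = ?s"
    by (rule sum.reindex_bij_witness[of _ "\<lambda>a. a * b" "\<lambda>a. a * inverse b"])
      (use b in \<open>auto simp: mult.commute\<close>)
  finally have "(b ^ i - 1) * ?s = 0" by (simp add: algebra_simps)
  then show ?thesis using b by simp
qed

text \<open>Multiplication by \<open>a\<close> permutes the nonzero elements, so their product is
  unchanged by the factor \<open>a ^ (q - 1)\<close>.\<close>

lemma finite_field_power_eq_1: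
  fixes a :: "'a :: {field, finite}"
  assumes "a \<noteq> 0"
  shows "a ^ (card (UNIV :: 'a set) - 1) = 1"
proof -
  have "(\<Prod>x \<in> (UNIV :: 'a set) - {0}. a * x) = (\<Prod>x \<in> (UNIV :: 'a set) - {0}. x)"
    by (rule prod.reindex_bij_witness[of _ "\<lambda>x. inverse a * x" "\<lambda>x. a * x"])
      (use assms in auto)
  then have "a ^ card ((UNIV :: 'a set) - {0}) * (\<Prod>x \<in> (UNIV :: 'a set) - {0}. x)
      = (\<Prod>x \<in> (UNIV :: 'a set) - {0}. x)"
    by (simp add: prod.distrib)
  moreover have "(\<Prod>x \<in> (UNIV :: 'a set) - {0}. x) \<noteq> 0" by simp
  ultimately show ?thesis by (simp add: card_Diff_subset)
qed

context cyclic_hamming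
begin

text \<open>For \<open>d = gcd n (q - 1)\<close> and the shift \<open>S\<close> by \<open>n/d\<close> columns we have \<open>S\<^bsup>q - 1\<^esup> = 1\<close>, so that
  \<open>S\<close> is diagonalizable over the field; the vectors \<open>W a\<close> below are the components of \<open>col H 0\<close> in the eigenspaces of \<open>S\<close>, up to sign.
  An eigenvector of \<open>S\<close> is a multiple of a column of \<open>H\<close>, and \<open>S\<close> maps it to a multiple of itself only if
  \<open>n\<close> divides \<open>n/d\<close>.\<close>

lemma gcd_length: "gcd n (card (UNIV :: 'a set) - 1) = 1"
proof -
  define Q where "Q = card (UNIV :: 'a set) - 1"
  define d where "d = gcd n Q"
  define e where "e = n div d"
  have card_UNIV_ge: "card (UNIV :: 'a set) \<ge> 2"
    using card_mono[of "UNIV :: 'a set" "{0, 1}"] by simp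
  have n: "n = e * d" by (simp add: e_def d_def)
  obtain t where t: "Q = d * t" unfolding d_def by (metis dvd_def gcd_dvd2)
  define h where "h i = col H ((e * i) mod n)" for i
  have hQ: "h Q = h 0" by (simp add: h_def t n mult.assoc[symmetric])
  have h_carrier: "h i \<in> carrier_vec k" for i
    using n_ge_2 by (auto simp: h_def intro: col_carrier)
  \<comment> \<open>The inverse powers of \<open>a\<close> weight the orbit of \<open>h 0\<close> so
    that moving one step along it becomes multiplication by \<open>a\<close>.\<close>
  define W where "W a = vec k (\<lambda>r. \<Sum>i<Q. inverse a ^ i * h i $ r)" for a
  have "power e *\<^sub>v h i = h (Suc i)" for i
    using n_ge_2 by (simp add: h_def power_col mod_simps add.commute)
  then obtain E where E_eq: "E = power e" and h_Suc: "\<And>i. E *\<^sub>v h i = h (Suc i)" by blast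
  have E: "E \<in> carrier_mat k k" unfolding E_eq by (rule power_carrier)
  have eigen: "E *\<^sub>v W a = a \<cdot>\<^sub>v W a" if a: "a \<noteq> 0" for a
  proof (rule eq_vecI)
    fix r assume "r < dim_vec (a \<cdot>\<^sub>v W a)"
    then have r: "r < k" by (simp add: W_def)
    let ?g = "\<lambda>i. inverse a ^ i * h i $ r"
    have step: "(\<Sum>l<k. E $$ (r, l) * h i $ l) = h (Suc i) $ r" for i
      using r E h_carrier[of i]
      unfolding h_Suc[symmetric] by (simp add: scalar_prod_def atLeast0LessThan)
    have "(E *\<^sub>v W a) $ r = (\<Sum>l<k. E $$ (r, l) * (\<Sum>i<Q. inverse a ^ i * h i $ l))"
      using r E by (simp add: scalar_prod_def W_def atLeast0LessThan)
    also have "\<dots> = (\<Sum>l<k. \<Sum>i<Q. inverse a ^ i * (E $$ (r, l) * h i $ l))"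
      by (simp add: sum_distrib_left mult.left_commute)
    also have "\<dots> = (\<Sum>i<Q. \<Sum>l<k. inverse a ^ i * (E $$ (r, l) * h i $ l))"
      by (rule sum.swap)
    also have "\<dots> = (\<Sum>i<Q. inverse a ^ i * h (Suc i) $ r)"
      by (simp add: sum_distrib_left[symmetric] step)
    also have "\<dots> = a * (\<Sum>i<Q. ?g (Suc i))"
      using a by (simp add: sum_distrib_left mult.assoc[symmetric])
    \<comment> \<open>The sum runs over a full period: \<open>a ^ Q = 1\<close> and
      \<open>h Q = h 0\<close>, so that \<open>?g Q = ?g 0\<close>.\<close>
    also have "(\<Sum>i<Q. ?g (Suc i)) = (\<Sum>i<Q. ?g i)"
    proof -
      have "(\<Sum>i<Q. ?g (Suc i) - ?g i) = ?g Q - ?g 0" by (rule sum_lessThan_telescope)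
      also have "\<dots> = 0"
        using finite_field_power_eq_1[of "inverse a", folded Q_def] a by (simp add: hQ)
      finally show ?thesis by (simp add: sum_subtractf)
    qed
    finally show "(E *\<^sub>v W a) $ r = (a \<cdot>\<^sub>v W a) $ r" using r by (simp add: W_def)
  qed (use E in \<open>auto simp: W_def\<close>)
  have "\<exists>a. a \<noteq> 0 \<and> W a \<noteq> 0\<^sub>v k"
  proof (rule ccontr)
    assume "\<not> (\<exists>a. a \<noteq> 0 \<and> W a \<noteq> 0\<^sub>v k)"
    then have zero: "W a = 0\<^sub>v k" if "a \<noteq> 0" for a using that by blast
    \<comment> \<open>Summing \<open>W a\<close> over all nonzero \<open>a\<close> leaves only the
      term \<open>i = 0\<close>, which is \<open>Q\<close> times \<open>h 0\<close>, that is,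
      \<open>- h 0\<close>.\<close>
    have "h 0 $ r = 0" if r: "r < k" for r
    proof -
      have "0 = (\<Sum>a \<in> UNIV - {0}. W a $ r)" using zero r by simp
      also have "\<dots> = (\<Sum>a \<in> UNIV - {0}. \<Sum>i<Q. inverse a ^ i * h i $ r)"
        using r by (simp add: W_def)
      also have "\<dots> = (\<Sum>i<Q. \<Sum>a \<in> UNIV - {0}. inverse a ^ i * h i $ r)" by (rule sum.swap)
      also have "\<dots> = (\<Sum>i<Q. if i = 0 then of_nat Q * h 0 $ r else 0)"
      proof (intro sum.cong refl)
        fix i assume i: "i \<in> {..<Q}"
        show "(\<Sum>a \<in> UNIV - {0}. inverse a ^ i * h i $ r) = (if i = 0 then of_nat Q * h 0 $ r else 0)"
        proof (cases "i = 0")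
          case True
          then show ?thesis by (simp add: Q_def card_Diff_subset)
        next
          case False
          then show ?thesis using sum_powers_field[of i, where 'a = 'a] i
            by (simp add: Q_def sum_distrib_right[symmetric])
        qed
      qed
      also have "\<dots> = of_nat Q * h 0 $ r" using card_UNIV_ge by (simp add: Q_def)
      also have "(of_nat Q :: 'a) = - 1"
        using card_UNIV_ge of_nat_card_field[where 'a = 'a] by (simp add: Q_def of_nat_diff)
      finally show ?thesis by simp
    qed
    then have "h 0 = 0\<^sub>v k" using h_carrier[of 0] by (intro eq_vecI) auto
    then show False using col_nonzero[of 0] n_ge_2 by (simp add: h_def)
  qed
  then obtain a where a: "a \<noteq> 0" "W a \<noteq> 0\<^sub>v k" by blast
  have W: "W a \<in> carrier_vec k" by (simp add: W_def)
  have "power 0 *\<^sub>v W a = W a" using W shift_carrier by simp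
  then have "e mod n = 0 mod n" using power_eigen[OF W a(2), of e a 0] eigen[OF a(1)] a(1) by (simp add: E_eq)
  moreover have "e > 0" using n n_ge_2 by (cases e) auto
  ultimately have "n \<le> e" by (cases "e < n") auto
  then have "d \<le> 1" using n \<open>e > 0\<close> by simp
  moreover have "d \<noteq> 0" using n n_ge_2 by (cases d) auto
  ultimately have "d = 1" by simp
  then show ?thesis by (simp add: d_def Q_def)
qed

end

section \<open>The code of the shifted block matrix\<close>

lemma smult_append_vec:
  "a \<cdot>\<^sub>v (v @\<^sub>v w) = (a \<cdot>\<^sub>v v) @\<^sub>v (a \<cdot>\<^sub>v w)"
  by (intro eq_vecI) auto

text \<open>Shifting to the right \<open>i\<close> times brings column \<open>j - i\<close> to
  position \<open>j\<close>. The summand \<open>(dim_col A - 1) * i\<close> represents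
  \<open>- i\<close> modulo the number of columns without subtracting \<open>i\<close>.\<close>

lemma shift_cols_power:
  "(shift_cols ^^ i) A \<in> carrier_mat (dim_row A) (dim_col A)
    \<and> (\<forall>r < dim_row A. \<forall>j < dim_col A.
      (shift_cols ^^ i) A $$ (r, j) = A $$ (r, (j + (dim_col A - 1) * i) mod dim_col A))"
proof (induction i)
  case (Suc i)
  have "((j + dim_col A - 1) mod dim_col A + (dim_col A - 1) * i) mod dim_col A
      = (j + (dim_col A - 1) * Suc i) mod dim_col A" if "j < dim_col A" for j
    using that by (simp add: mod_simps add.assoc)
  then show ?case using Suc by (auto simp: shift_cols_def)
qed auto

text \<open>Adding \<open>i + j\<close> turns the two sides into \<open>j\<close> and
  \<open>i\<close> modulo \<open>n\<close>, and \<open>{1..n}\<close> represents each residue once,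
  with \<open>n\<close> standing for 0.\<close>

lemma mult_pred_mod_inj:
  fixes i j n :: nat
  assumes "((n - 1) * i) mod n = ((n - 1) * j) mod n" "i \<in> {1..n}" "j \<in> {1..n}"
  shows "i = j"
proof -
  obtain t where n: "n = Suc t" using assms by (cases n) auto
  have "((n - 1) * i + (i + j)) mod n = ((n - 1) * j + (i + j)) mod n"
    using assms(1) by (rule mod_add_cong) simp
  moreover have "(n - 1) * i + (i + j) = n * i + j" "(n - 1) * j + (i + j) = n * j + i"
    by (simp_all add: n)
  ultimately have "(n * i + j) mod n = (n * j + i) mod n" by (simp only:)
  then have "j mod n = i mod n" by simp
  then show ?thesis using assms(2,3) by (cases "i = n"; cases "j = n") auto
qed

section \<open>The subspaces attached to the blocks\<close>

locale shifted_code = cyclic_hamming +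
  fixes c :: nat
  assumes c: "c \<in> {2..n}"
begin

text \<open>The exponent \<open>(n - 1) * i\<close> stands for \<open>- i\<close>, as \<open>shift\<close> has order \<open>n\<close>.\<close>

definition twist :: "nat \<Rightarrow> 'a vec \<Rightarrow> 'a vec" where
  "twist i v = v @\<^sub>v (power ((n - 1) * i) *\<^sub>v v)"

lemma power_mult_carrier: "v \<in> carrier_vec k \<Longrightarrow> power e *\<^sub>v v \<in> carrier_vec k"
  using power_carrier[of e] by auto

lemma twist_carrier: "v \<in> carrier_vec k \<Longrightarrow> twist i v \<in> carrier_vec (2 * k)"
  using append_carrier_vec[OF _ power_mult_carrier, of v k v] by (simp add: twist_def mult_2)

lemma twist_add:
  assumes "u \<in> carrier_vec k" "v \<in> carrier_vec k"
  shows "twist i (u + v) = twist i u + twist i v"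
  unfolding twist_def
  using append_vec_add[OF assms power_mult_carrier[OF assms(1)] power_mult_carrier[OF assms(2)]]
  by (simp add: mult_add_distrib_mat_vec[OF power_carrier assms])

lemma twist_smult: "v \<in> carrier_vec k \<Longrightarrow> twist i (a \<cdot>\<^sub>v v) = a \<cdot>\<^sub>v twist i v"
  by (simp add: twist_def smult_append_vec mult_mat_vec[OF power_carrier])

lemma twist_inj:
  assumes "u \<in> carrier_vec k" "v \<in> carrier_vec k" "twist i u = twist j v"
  shows "u = v"
  using assms append_vec_eq[OF assms(1,2)] by (simp add: twist_def)

lemma zero_smult: "v \<in> carrier_vec m \<Longrightarrow> (0 :: 'a) \<cdot>\<^sub>v v = 0\<^sub>v m"
  by (intro eq_vecI) auto

lemma twist_zero: "twist i (0\<^sub>v k) = 0\<^sub>v (2 * k)"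
  using twist_smult[of "0\<^sub>v k" i 0] zero_smult[of "0\<^sub>v k" k]
    zero_smult[OF twist_carrier[of "0\<^sub>v k" i]] by simp

lemma twist_uminus:
  assumes "v \<in> carrier_vec k" shows "twist i (- v) = - twist i v"
proof -
  have neg: "- w = (- 1) \<cdot>\<^sub>v w" for w :: "'a vec" by (intro eq_vecI) auto
  show ?thesis unfolding neg using assms by (rule twist_smult)
qed

text \<open>Write \<open>w\<close> as \<open>(x, y)\<close>. Comparing the halves of
  \<open>w + twist i v\<close> and \<open>twist j u\<close> forces \<open>u = x + v\<close> and
  leaves the linear equation \<open>B v = y - ?A j x\<close>. A nonzero kernel vector of
  \<open>B\<close> would have equal images under two different powers of the shift, contrary to
  \<open>power_eigen\<close>; so \<open>B\<close> is injective, hence bijective on a finite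
  space.\<close>

lemma twist_complement:
  assumes i: "i \<in> {1..c}" and j: "j \<in> {1..c}" and "i \<noteq> j" and w: "w \<in> carrier_vec (2 * k)"
  shows "\<exists>!v. v \<in> twist i ` carrier_vec k \<and> w + v \<in> twist j ` carrier_vec k"
proof -
  let ?A = "\<lambda>i. power ((n - 1) * i)"
  define B where "B = ?A j - ?A i"
  have B: "B \<in> carrier_mat k k" unfolding B_def using power_carrier by (intro minus_carrier_mat)
  have Bv: "B *\<^sub>v v = ?A j *\<^sub>v v - ?A i *\<^sub>v v" if "v \<in> carrier_vec k" for v
    unfolding B_def using that power_carrier by (intro minus_mult_distrib_mat_vec)
  have inj: "inj_on ((*\<^sub>v) B) (carrier_vec k)"
  proof (rule inj_onI, rule ccontr)
    fix u v assume uv: "u \<in> carrier_vec k" "v \<in> carrier_vec k" "B *\<^sub>v u = B *\<^sub>v v" "u \<noteq> v"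
    let ?z = "u - v"
    have z: "?z \<in> carrier_vec k" using uv by simp
    have "B *\<^sub>v ?z = B *\<^sub>v u - B *\<^sub>v v" using uv B by (intro mult_minus_distrib_mat_vec)
    also have "\<dots> = 0\<^sub>v k" using uv B by auto
    finally have "?A j *\<^sub>v ?z - ?A i *\<^sub>v ?z = 0\<^sub>v k" using Bv[OF z] by simp
    then have "?A j *\<^sub>v ?z = ?A i *\<^sub>v ?z"
      using minus_vec_eq_zero_iff[OF power_mult_carrier[OF z] power_mult_carrier[OF z]] by blast
    then have eq: "?A j *\<^sub>v ?z = 1 \<cdot>\<^sub>v (?A i *\<^sub>v ?z)" by simp
    have "?z \<noteq> 0\<^sub>v k" using minus_vec_eq_zero_iff[OF uv(1,2)] uv(4) by simp
    from power_eigen[OF z this eq] have "((n - 1) * j) mod n = ((n - 1) * i) mod n" by simp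
    then show False using mult_pred_mod_inj[of n j i] i j c \<open>i \<noteq> j\<close> by simp
  qed
  have "(*\<^sub>v) B ` carrier_vec k \<subseteq> carrier_vec k" using B by auto
  then have surj: "(*\<^sub>v) B ` carrier_vec k = carrier_vec k"
    using endo_inj_surj[OF finite_carrier_vec _ inj] by blast
  define x y where "x = vec_first w k" and "y = vec_last w k"
  have xy: "x \<in> carrier_vec k" "y \<in> carrier_vec k" by (simp_all add: x_def y_def)
  have w_eq: "w = x @\<^sub>v y"
    using w vec_first_last_append[of w k k] by (simp add: x_def y_def mult_2)
  have sum: "w + twist i v = (x + v) @\<^sub>v (y + ?A i *\<^sub>v v)" if v: "v \<in> carrier_vec k" for v
    unfolding w_eq twist_def using append_vec_add[OF xy(1) v xy(2) power_mult_carrier[OF v]] .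
  have key: "w + twist i v \<in> twist j ` carrier_vec k \<longleftrightarrow> B *\<^sub>v v = y - ?A j *\<^sub>v x"
    if v: "v \<in> carrier_vec k" for v
  proof -
    have xv: "x + v \<in> carrier_vec k" using xy v by simp
    have "w + twist i v \<in> twist j ` carrier_vec k \<longleftrightarrow> (\<exists>u \<in> carrier_vec k.
        x + v = u \<and> y + ?A i *\<^sub>v v = ?A j *\<^sub>v u)"
      unfolding sum[OF v] unfolding twist_def image_iff
      by (intro bex_cong refl) (simp only: append_vec_eq[OF xv])
    also have "\<dots> \<longleftrightarrow> y + ?A i *\<^sub>v v = ?A j *\<^sub>v x + ?A j *\<^sub>v v"
      using xv mult_add_distrib_mat_vec[OF power_carrier xy(1) v] by auto
    also have "\<dots> \<longleftrightarrow> B *\<^sub>v v = y - ?A j *\<^sub>v x"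
      unfolding Bv[OF v]
      by (rule add_vec_eq_add_vec_iff[OF power_mult_carrier[OF v] power_mult_carrier[OF v]
            power_mult_carrier[OF xy(1)] xy(2)])
    finally show ?thesis .
  qed
  have "y - ?A j *\<^sub>v x \<in> (*\<^sub>v) B ` carrier_vec k"
    unfolding surj using xy power_mult_carrier by simp
  then obtain v where v: "v \<in> carrier_vec k" "B *\<^sub>v v = y - ?A j *\<^sub>v x" by auto
  show ?thesis
  proof (rule ex1I[of _ "twist i v"])
    show "twist i v \<in> twist i ` carrier_vec k \<and> w + twist i v \<in> twist j ` carrier_vec k"
      using v key by blast
  next
    fix t assume t: "t \<in> twist i ` carrier_vec k \<and> w + t \<in> twist j ` carrier_vec k"
    then obtain u where u: "u \<in> carrier_vec k" "t = twist i u" by blast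
    then have "B *\<^sub>v u = B *\<^sub>v v" using t key v(2) by metis
    then have "u = v" using inj_onD[OF inj _ u(1) v(1)] by simp
    then show "t = twist i v" using u by simp
  qed
qed

sublocale spread: partial_spread "2 * k" "Suc ((card (UNIV :: 'a set) - 1) * n)" "{1..c}"
  "\<lambda>i. twist i ` carrier_vec k"
proof
  show "finite {1..c}" by simp
next
  fix i show "twist i ` carrier_vec k \<subseteq> carrier_vec (2 * k)" using twist_carrier by blast
next
  fix i show "0\<^sub>v (2 * k) \<in> twist i ` carrier_vec k"
    using twist_zero[of i] by (intro image_eqI[of _ _ "0\<^sub>v k"]) simp_all
next
  fix i and u v :: "'a vec" assume "u \<in> twist i ` carrier_vec k" "v \<in> twist i ` carrier_vec k"
  then obtain x y where xy: "x \<in> carrier_vec k" "y \<in> carrier_vec k"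
    and uv: "u = twist i x" "v = twist i y" by blast
  show "u + v \<in> twist i ` carrier_vec k"
    unfolding uv using twist_add[OF xy, of i] xy by (intro image_eqI[of _ _ "x + y"]) auto
next
  fix i and w :: "'a vec" assume "w \<in> twist i ` carrier_vec k"
  then obtain x where x: "x \<in> carrier_vec k" "w = twist i x" by blast
  show "- w \<in> twist i ` carrier_vec k"
    unfolding x(2) using twist_uminus[OF x(1), of i] x(1) by (intro image_eqI[of _ _ "- x"]) auto
next
  fix i
  have "inj_on (twist i) (carrier_vec k)" using twist_inj by (blast intro: inj_onI)
  then show "card (twist i ` carrier_vec k) = Suc ((card (UNIV :: 'a set) - 1) * n)"
    by (simp add: card_image card_carrier)
next
  fix i j and w :: "'a vec" assume "i \<in> {1..c}" "j \<in> {1..c}" "i \<noteq> j" "w \<in> carrier_vec (2 * k)"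
  then show "\<exists>!v. v \<in> twist i ` carrier_vec k \<and> w + v \<in> twist j ` carrier_vec k"
    by (rule twist_complement)
qed

section \<open>Columns of the block matrix\<close>

abbreviation check :: "'a mat" where
  "check \<equiv> shifted_block_matrix c H"

lemma check_carrier: "check \<in> carrier_mat (2 * k) (n * c)"
  using P_carrier by (simp add: shifted_block_matrix_def)

text \<open>Blocks are numbered from 0 while the shifts start at 1, so the columns of block
  \<open>i\<close> lie in the subspace of index \<open>i + 1\<close>.\<close>

lemma col_check:
  assumes "l < n" "i < c"
  shows "col check (n * i + l) = twist (i + 1) (col H l)"
proof -
  have lt: "n * i + l < n * c"
  proof -
    have "n * i + l < n * Suc i" using assms by simp
    also have "\<dots> \<le> n * c" using assms by (intro mult_le_mono) auto
    finally show ?thesis .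
  qed
  have n: "(n * i + l) div n = i" "(n * i + l) mod n = l" using assms by auto
  have t: "twist (i + 1) (col H l) = col H l @\<^sub>v col H ((l + (n - 1) * (i + 1)) mod n)"
    unfolding twist_def by (simp only: power_col[OF assms(1)])
  have dims: "dim_row H = k" "dim_col H = n" using P_carrier by auto
  have "(shift_cols ^^ (i + 1)) H $$ (r, l) = H $$ (r, (l + (n - 1) * (i + 1)) mod n)" if "r < k" for r
    using shift_cols_power[of "i + 1" H] dims that assms(1) by blast
  then show ?thesis
    unfolding t using lt n dims assms n_ge_2
    by (intro eq_vecI) (auto simp: shifted_block_matrix_def Let_def)
qed

lemma index_cases:
  assumes "j < n * c"
  obtains i l where "l < n" "i < c" "j = n * i + l"
proof
  show "j mod n < n" using n_ge_2 by simp
  show "j div n < c" using assms by (simp add: less_mult_imp_div_less mult.commute)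
  show "j = n * (j div n) + j mod n" by simp
qed

lemma col_check_in:
  assumes "j < n * c"
  obtains i l where "l < n" "i < c" "j = n * i + l" "\<And>a. a \<cdot>\<^sub>v col check j = twist (i + 1) (a \<cdot>\<^sub>v col H l)"
proof -
  obtain i l where il: "l < n" "i < c" "j = n * i + l" using assms by (rule index_cases)
  have "a \<cdot>\<^sub>v col check j = twist (i + 1) (a \<cdot>\<^sub>v col H l)" for a
    unfolding il(3) col_check[OF il(1,2)] by (rule twist_smult[OF col_carrier[OF il(1)], symmetric])
  then show thesis using that il by blast
qed

text \<open>Equal multiples of two columns have equal upper halves, so the scalars and the positions
  within the blocks agree. Different blocks are excluded because their subspaces meet only in
  zero.\<close>

sublocale check: projective_system check "2 * k" "n * c"
proof
  have nz: "a \<cdot>\<^sub>v col H l \<noteq> 0\<^sub>v k" if "a \<noteq> 0" "l < n" for a l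
    using zero_notin_multiples that unfolding multiples_iff by metis
  show "check \<in> carrier_mat (2 * k) (n * c)" by (rule check_carrier)
  {
    fix j assume "j < n * c"
    then obtain i l where "l < n" "i < c" "j = n * i + l" by (rule index_cases)
    then have "col check j = twist (i + 1) (col H l)" using col_check by simp
    moreover have "twist (i + 1) (col H l) \<noteq> twist (i + 1) (0\<^sub>v k)"
      using twist_inj[OF col_carrier] col_nonzero \<open>l < n\<close> by (metis zero_carrier_vec)
    ultimately show "col check j \<noteq> 0\<^sub>v (2 * k)" using twist_zero by simp
  }
  fix a b i j assume ab: "a \<noteq> 0" "b \<noteq> 0" and ij: "i < n * c" "j < n * c"
    and eq: "a \<cdot>\<^sub>v col check i = b \<cdot>\<^sub>v col check j"
  obtain i1 l1 where i: "l1 < n" "i1 < c" "i = n * i1 + l1"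
    "a \<cdot>\<^sub>v col check i = twist (i1 + 1) (a \<cdot>\<^sub>v col H l1)" using col_check_in[OF ij(1)] by metis
  obtain j1 l2 where j: "l2 < n" "j1 < c" "j = n * j1 + l2"
    "b \<cdot>\<^sub>v col check j = twist (j1 + 1) (b \<cdot>\<^sub>v col H l2)" using col_check_in[OF ij(2)] by metis
  have cc: "a \<cdot>\<^sub>v col H l1 \<in> carrier_vec k" "b \<cdot>\<^sub>v col H l2 \<in> carrier_vec k"
    using col_carrier i j by auto
  have same: "twist (i1 + 1) (a \<cdot>\<^sub>v col H l1) = twist (j1 + 1) (b \<cdot>\<^sub>v col H l2)"
    using eq i j by simp
  then have "a \<cdot>\<^sub>v col H l1 = b \<cdot>\<^sub>v col H l2" using twist_inj cc by blast
  then have "a = b" "l1 = l2" using col_inj ab i j by auto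
  moreover have "i1 = j1"
  proof (rule ccontr)
    assume "i1 \<noteq> j1"
    have "twist (i1 + 1) (a \<cdot>\<^sub>v col H l1) \<in> twist (j1 + 1) ` carrier_vec k"
      unfolding same using cc(2) by (rule imageI)
    moreover have "twist (i1 + 1) (a \<cdot>\<^sub>v col H l1) \<in> twist (i1 + 1) ` carrier_vec k"
      using cc(1) by (rule imageI)
    moreover have "i1 + 1 \<in> {1..c}" "j1 + 1 \<in> {1..c}" "i1 + 1 \<noteq> j1 + 1"
      using i j \<open>i1 \<noteq> j1\<close> by auto
    ultimately have "twist (i1 + 1) (a \<cdot>\<^sub>v col H l1) = 0\<^sub>v (2 * k)"
      by (intro spread.V_inter)
    then have "a \<cdot>\<^sub>v col H l1 = 0\<^sub>v k" using twist_zero twist_inj cc(1) by (metis zero_carrier_vec)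
    then show False using nz ab i by blast
  qed
  ultimately show "a = b \<and> i = j" using i j by simp
qed

text \<open>A nonzero element of the \<open>i\<close>-th subspace is \<open>twist i\<close> of a
  multiple of a column of \<open>H\<close>, hence a multiple of a column in the \<open>i\<close>-th
  block. This makes the counts for partial spreads available for the code.\<close>

lemma check_multiples: "check.multiples = spread.points"
proof (intro equalityI subsetI)
  fix v assume v: "v \<in> check.multiples"
  then obtain a j where a: "a \<noteq> 0" "j < n * c" "v = a \<cdot>\<^sub>v col check j"
    unfolding check.multiples_iff by blast
  obtain i l where "l < n" "i < c" "v = twist (i + 1) (a \<cdot>\<^sub>v col H l)"
    using col_check_in[OF a(2)] a(3) by metis
  then have "v \<in> twist (i + 1) ` carrier_vec k" "i + 1 \<in> {1..c}" using col_carrier by auto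
  moreover have "v \<noteq> 0\<^sub>v (2 * k)" using v check.zero_notin_multiples by auto
  ultimately show "v \<in> spread.points" unfolding spread.points_def by blast
next
  fix w assume "w \<in> spread.points"
  then obtain i v where i: "i \<in> {1..c}" and v: "v \<in> carrier_vec k" "w = twist i v" "w \<noteq> 0\<^sub>v (2 * k)"
    unfolding spread.points_def by blast
  then have "v \<noteq> 0\<^sub>v k" using twist_zero by auto
  then obtain a l where a: "a \<noteq> 0" "l < n" "v = a \<cdot>\<^sub>v col H l" using nonzero_cases v by metis
  have i': "i - 1 < c" "i - 1 + 1 = i" using i by auto
  have "w = a \<cdot>\<^sub>v col check (n * (i - 1) + l)"
    unfolding col_check[OF a(2) i'(1)] i'(2) v(2) a(3) by (rule twist_smult[OF col_carrier[OF a(2)]])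
  moreover have "n * (i - 1) + l < n * c"
  proof -
    have "n * (i - 1) + l < n * Suc (i - 1)" using a by simp
    also have "\<dots> \<le> n * c" using i by (intro mult_le_mono) auto
    finally show ?thesis .
  qed
  ultimately show "w \<in> check.multiples" using a unfolding check.multiples_iff by blast
qed

text \<open>A field has at least two elements, so the bound follows from \<open>c \<le> n\<close>.
  It serves \<open>points_not_all\<close> and the differences in the intersection array.\<close>

lemma c_le: "c \<le> (card (UNIV :: 'a set) - 1) * n"
proof -
  have "card {0, 1 :: 'a} \<le> card (UNIV :: 'a set)" by (intro card_mono) auto
  then have "1 * n \<le> (card (UNIV :: 'a set) - 1) * n" by (intro mult_le_mono1) simp
  then show ?thesis using c by (metis atLeastAtMost_iff le_trans mult_1)
qed

sublocale two_layer_code check "2 * k" "n * c"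
  "Suc ((card (UNIV :: 'a set) - 1) * n) - 2 + (c - 1) * (c - 2)" "c * (c - 1)"
proof
  have I: "card {1..c} \<ge> 2" "card {1..c} < Suc ((card (UNIV :: 'a set) - 1) * n)"
    using c c_le by (simp_all add: less_Suc_eq_le)
  show "\<exists>d \<in> check.multiples. w + d \<in> check.multiples"
    if "w \<in> carrier_vec (2 * k)" "w \<noteq> 0\<^sub>v (2 * k)" "w \<notin> check.multiples" for w
    using spread.points_sum[OF I(1)] that unfolding check_multiples by blast
  show "\<exists>w \<in> carrier_vec (2 * k). w \<noteq> 0\<^sub>v (2 * k) \<and> w \<notin> check.multiples"
    unfolding check_multiples by (rule spread.points_not_all[OF I])
  show "card {d \<in> check.multiples. w + d \<in> check.multiples}
      = Suc ((card (UNIV :: 'a set) - 1) * n) - 2 + (c - 1) * (c - 2)"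
    if "w \<in> check.multiples" for w
    using spread.count_on_points that unfolding check_multiples by simp
  show "card {d \<in> check.multiples. w + d \<in> check.multiples} = c * (c - 1)"
    if "w \<in> carrier_vec (2 * k)" "w \<noteq> 0\<^sub>v (2 * k)" "w \<notin> check.multiples" for w
    using spread.count_off_points that unfolding check_multiples by simp
  \<comment> \<open>Two columns of the first block lie in a common subspace, and so does their sum,
    which is nonzero because distinct columns are not proportional.\<close>
  show "\<exists>i j. i < n * c \<and> j < n * c \<and> i \<noteq> j \<and> col check i + col check j \<in> check.multiples"
  proof -
    have lt: "0 < n" "1 < n" "0 < c" and lt': "0 < n * c" "1 < n * c"
      using n_ge_2 c by (auto simp: Suc_lessI)
    have cols: "col check 0 = twist 1 (col H 0)" "col check 1 = twist 1 (col H 1)"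
      using col_check[OF lt(1,3)] col_check[OF lt(2,3)] by auto
    have cc: "col H 0 \<in> carrier_vec k" "col H 1 \<in> carrier_vec k" using col_carrier lt by auto
    have "col H 0 + col H 1 \<noteq> 0\<^sub>v k"
    proof
      assume "col H 0 + col H 1 = 0\<^sub>v k"
      then have "col H 1 = - col H 0" using add_vec_eq_zero_iff[OF cc] by simp
      then have "1 \<cdot>\<^sub>v col H 1 = (- 1) \<cdot>\<^sub>v col H 0" by (auto intro!: eq_vecI)
      then show False using col_inj[of 1 "- 1" 1 0] lt by simp
    qed
    then have "twist 1 (col H 0 + col H 1) \<noteq> 0\<^sub>v (2 * k)"
      using twist_inj[of "col H 0 + col H 1" "0\<^sub>v k" 1 1] twist_zero cc by auto
    moreover have "twist 1 (col H 0 + col H 1) \<in> twist 1 ` carrier_vec k" using cc by simp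
    moreover have "1 \<in> {1..c}" using c by simp
    ultimately have "twist 1 (col H 0 + col H 1) \<in> spread.points" unfolding spread.points_def by blast
    then show ?thesis using lt' cols twist_add[OF cc] check_multiples
      by (intro exI[of _ 0] exI[of _ 1]) auto
  qed
qed

end

theorem corollary2:
  fixes H :: "'a :: {field, finite} mat" and q k n c :: nat and C :: "'a vec set"
  assumes "q = card (UNIV :: 'a set)"
    and "k \<ge> 1"
    and "n = (q ^ k - 1) div (q - 1)"
    and "hamming_check_matrix k n H"
    and "cyclic_code (mat_kernel H)"
    and "c \<in> {2..n}"
    and "C = mat_kernel (shifted_block_matrix c H)"
  shows "gcd n (q - 1) = 1
    \<and> quasi_perfect (n * c) C
    \<and> uniformly_packed (n * c) C
    \<and> completely_regular (n * c) C
    \<and> linear_code_params (n * c) (n * c - 2 * k) 3 2 C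
    \<and> has_intersection_array (n * c) C
        [(q - 1) * n * c, ((q - 1) * n - c + 2) * (c - 1)] [1, c * (c - 1)]"
proof -
  interpret projective_system H k n by (rule hamming_projective_system[OF assms(4)])
  interpret cyclic_hamming H k n
    using assms hamming_multiples[OF assms(4)] by unfold_locales auto
  interpret shifted_code H k n c using assms(6) by unfold_locales
  let ?Q = "(q - 1) * n"
  have C: "C = check.code" by (rule assms(7))
  \<comment> \<open>Since \<open>2 \<le> c\<close> and \<open>c \<le> ?Q\<close>, the substitutions
    \<open>c = s + 2\<close> and \<open>?Q = s + 2 + t\<close> remove the truncated
    differences.\<close>
  have array: "?Q * c - 1 - (Suc ?Q - 2 + (c - 1) * (c - 2)) = (?Q - c + 2) * (c - 1)"
  proof -
    obtain s where s: "c = s + 2" using assms(6) by (metis add.commute atLeastAtMost_iff le_Suc_ex)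
    have "c \<le> ?Q" unfolding assms(1) by (rule c_le)
    then obtain t where t: "?Q = s + 2 + t" using s le_Suc_ex by blast
    show ?thesis unfolding t s by (simp add: algebra_simps)
  qed
  have "has_intersection_array (n * c) C
      [(q - 1) * n * c, ((q - 1) * n - c + 2) * (c - 1)] [1, c * (c - 1)]"
    unfolding has_intersection_array_def C covering_radius_code
  proof (intro exI conjI, rule intersection_numbers_code)
    have "[0..<2] = [0, 1]" "[1..<Suc 2] = [1, 2]" by (simp_all add: numeral_2_eq_2)
    then show "[(q - 1) * n * c, ((q - 1) * n - c + 2) * (c - 1)] = map (\<lambda>l. if l = 0 then
        (card (UNIV :: 'a set) - 1) * (n * c) else if l = 1 then (card (UNIV :: 'a set) - 1) * (n * c)
        - 1 - (Suc ((card (UNIV :: 'a set) - 1) * n) - 2 + (c - 1) * (c - 2)) else 0) [0..<2]"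
      and "[1, c * (c - 1)]
        = map (\<lambda>l. if l = 0 then 0 else if l = 1 then 1 else c * (c - 1)) [1..<Suc 2]"
      using array unfolding assms(1)[symmetric] by (simp_all add: mult.assoc)
  qed
  moreover have "linear_code_params (n * c) (n * c - 2 * k) 3 2 C"
    unfolding C linear_code_params_def
    using check.subspace_code dim_code min_distance_code covering_radius_code by linarith
  moreover have "completely_regular (n * c) C"
    unfolding C completely_regular_def using intersection_numbers_code by blast
  moreover have "gcd n (q - 1) = 1" unfolding assms(1) by (rule gcd_length)
  moreover have "quasi_perfect (n * c) C" unfolding C by (rule quasi_perfect_code)
  moreover have "uniformly_packed (n * c) C" unfolding C by (rule uniformly_packed_code)
  ultimately show ?thesis by (intro conjI)
qed

end
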